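(* Suppose that the analytical solution $(u^{(1)},u^{(2)},p)$ of the Stokes interface problem (described in the context) is sufficiently smooth on $\Omega$ excluding $\Gamma$. Let $(\widetilde u^{(1)},\widetilde u^{(2)},\widetilde p)$ be the auxiliary functions described in the context, let $(u_h^{(1)},u_h^{(2)},p_h)\in V_h^{(1)}\times V_h^{(2)}\times M_h$ be the solution of the modified MAC scheme, and set $$\widetilde e_u^{(1)}=u_h^{(1)}-\widetilde u^{(1)}\in V_h^{(1)},\quad \widetilde e_u^{(2)}=u_h^{(2)}-\widetilde u^{(2)}\in V_h^{(2)},\quad \widetilde e_p=p_h-\widetilde p\in M_h,\quad \widetilde{\mathbf e}_u=(\widetilde e_u^{(1)},\widetilde e_u^{(2)}).$$ Then there exists a positive constant $C$ independent of $h$ such that the discrete $H^1$-error estimate $$|\widetilde{\mathbf e}_u|_1\le Ch^2(\|\mathbf u\|_{4,\infty}+\|p\|_{3,\infty})$$ and the discrete $\ell^2$-error estimates $$\|\widetilde{\mathbf e}_u\|\le Ch^2(\|\mathbf u\|_{4,\infty}+\|p\|_{3,\infty}),\qquad \|\widetilde e_p\|_{M_h}\le Ch^2(\|\mathbf u\|_{4,\infty}+\|p\|_{3,\infty})$$ hold.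
   Context: **Problem.** $\Omega=(0,1)\times(0,1)$; $\Omega^+\subset\subset\Omega$ is simply connected with smooth boundary $\Gamma$ (the interface); $\Omega^-=\Omega\setminus\overline{\Omega^+}$. The Stokes interface problem (viscosity $\mu=1$, homogeneous boundary data) is $$-\Delta\mathbf u+\nabla p=\mathbf f,\quad \nabla\cdot\mathbf u=0\ \text{ in }\Omega^+\cup\Omega^-,\qquad [\![\mathbf u]\!]=\mathbf 0,\quad [\![\boldsymbol\sigma(\mathbf u,p)\mathbf n]\!]=\boldsymbol\psi\ \text{ on }\Gamma,\qquad \mathbf u=\mathbf 0\ \text{ on }\partial\Omega,$$ with $\mathbf u=(u^{(1)},u^{(2)})^T$, $\mathbf f=(f^{(1)},f^{(2)})^T$, $\boldsymbol\sigma(\mathbf u,p)=-p\mathbf I+\nabla\mathbf u+(\nabla\mathbf u)^T$, $\mathbf n$ the unit normal on $\Gamma$ pointing from $\Omega^+$ to $\Omega^-$, and $[\![v]\!]=v^+-v^-$, where $v^\pm$ are the limits from $\Omega^\pm$. "Sufficiently smooth on $\Omega$ excluding $\Gamma$" means smooth on each of the two sides, with one-sided limits of derivatives at $\Gamma$. $\|v\|_{r,\infty}=\max|\partial^{s+l}v/\partial x^s\partial y^l|$ over $s+l\le r$, $s,l\ge0$ (taken away from $\Gamma$; for vector functions also over components). **Grid.** $h=1/N$, $x_l=lh$, $y_m=mh$ ($l,m$ integers or half-integers), $v_{l,m}=v(x_l,y_m)$. The grid is assumed fine enough that $\Gamma$ does not meet an edge of a grid rectangle at more than two points (unless the edge is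 part of $\Gamma$), and if $\Gamma$ meets a rectangle at two points these are on two different edges. Difference operators: $\delta_{h,1}^+v_{l,m}=h^{-1}(v_{l+1,m}-v_{l,m})$, $\delta_{h,1}^-v_{l,m}=h^{-1}(v_{l,m}-v_{l-1,m})$, $\delta_{h,2}^+v_{l,m}=h^{-1}(v_{l,m+1}-v_{l,m})$, $\delta_{h,2}^-v_{l,m}=h^{-1}(v_{l,m}-v_{l,m-1})$, $\Delta_h=\delta_{h,1}^+\delta_{h,1}^-+\delta_{h,2}^+\delta_{h,2}^-$. **Discrete spaces.** - $V_h^{(1)}$: grid functions $v^{(1)}_{i,j-\frac12}$, $0\le i\le N$, $0\le j\le N+1$, with $v^{(1)}_{0,j-\frac12}=v^{(1)}_{N,j-\frac12}=0$, $v^{(1)}_{i,-\frac12}=-v^{(1)}_{i,\frac12}$, $v^{(1)}_{i,N+\frac12}=-v^{(1)}_{i,N-\frac12}$. - $V_h^{(2)}$: grid functions $v^{(2)}_{i-\frac12,j}$, $0\le i\le N+1$, $0\le j\le N$, with $v^{(2)}_{i-\frac12,0}=v^{(2)}_{i-\frac12,N}=0$, $v^{(2)}_{-\frac12,j}=-v^{(2)}_{\frac12,j}$, $v^{(2)}_{N+\frac12,j}=-v^{(2)}_{N-\frac12,j}$. - $M_h$: grid functions $q_{i-\frac12,j-\frac12}$, $1\le i,j\le N$, with $\sum_{i,j}q_{i-\frac12,j-\frac12}=0$. **Norms.** $\|v\|_{V_h^{(1)}}^2=h^2\sum_{i=1}^{N-1}\sum_{j=1}^N v_{i,j-\frac12}^2$;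 $\|v\|_{V_h^{(2)}}^2=h^2\sum_{i=1}^N\sum_{j=1}^{N-1}v_{i-\frac12,j}^2$; $\|q\|_{M_h}^2=h^2\sum_{i,j=1}^N q_{i-\frac12,j-\frac12}^2$; for vertex functions $w_{i,j}$, $\|w\|_{W_h^{(1)}}^2=h^2\sum_{i=1}^{N-1}\sum_{j=0}^N\rho_j w_{i,j}^2$ and $\|w\|_{W_h^{(2)}}^2=h^2\sum_{i=0}^N\sum_{j=1}^{N-1}\rho_i w_{i,j}^2$, with $\rho_0=\rho_N=\frac12$ and $\rho_k=1$ otherwise. For $\mathbf v_h=(v_h^{(1)},v_h^{(2)})\in V_h^{(1)}\times V_h^{(2)}$: $$\|\mathbf v_h\|^2=\|v_h^{(1)}\|_{V_h^{(1)}}^2+\|v_h^{(2)}\|_{V_h^{(2)}}^2,\quad |\mathbf v_h|_1^2=\|\delta_{h,1}^-v_h^{(1)}\|_{M_h}^2+\|\delta_{h,2}^-v_h^{(1)}\|_{W_h^{(1)}}^2+\|\delta_{h,1}^-v_h^{(2)}\|_{W_h^{(2)}}^2+\|\delta_{h,2}^-v_h^{(2)}\|_{M_h}^2,$$ where each difference quotient is placed at the midpoint of the two nodes it involves: $\delta_{h,1}^-v^{(1)}$ and $\delta_{h,2}^-v^{(2)}$ at cell centers, $\delta_{h,2}^-v^{(1)}$ at the vertex $(i,j)$ equal to $h^{-1}(v^{(1)}_{i,j+\frac12}-v^{(1)}_{i,j-\frac12})$, and $\delta_{h,1}^-v^{(2)}$ at the vertex $(i,j)$ equal to $h^{-1}(v^{(2)}_{i+\frac12,j}-v^{(2)}_{i-\frac12,j})$.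 **Modified MAC scheme.** $(u_h^{(1)},u_h^{(2)},p_h)\in V_h^{(1)}\times V_h^{(2)}\times M_h$ satisfies (subscript $h$ dropped) $$-\Delta_hu^{(1)}_{i,j-\frac12}+\delta_{h,1}^+p_{i-\frac12,j-\frac12}=\tilde f^{(1)}_{i,j-\frac12},\quad 1\le i\le N-1,\ 1\le j\le N,$$ $$-\Delta_hu^{(2)}_{i-\frac12,j}+\delta_{h,2}^+p_{i-\frac12,j-\frac12}=\tilde f^{(2)}_{i-\frac12,j},\quad 1\le i\le N,\ 1\le j\le N-1,$$ $$\delta_{h,1}^-u^{(1)}_{i,j-\frac12}+\delta_{h,2}^-u^{(2)}_{i-\frac12,j}=\tilde g_{i-\frac12,j-\frac12},\quad 1\le i,j\le N,$$ where $$\tilde f^{(1)}_{i,j-\frac12}=f^{(1)}_{i,j-\frac12}+C\{\Delta u^{(1)}\}_{i,j-\frac12}+C\{p_x\}_{i,j-\frac12},\qquad \tilde f^{(2)}_{i-\frac12,j}=f^{(2)}_{i-\frac12,j}+C\{\Delta u^{(2)}\}_{i-\frac12,j}+C\{p_y\}_{i-\frac12,j},$$ $$\tilde g_{i-\frac12,j-\frac12}=C\{u^{(1)}_x\}_{i-\frac12,j-\frac12}+C\{u^{(2)}_y\}_{i-\frac12,j-\frac12}.$$ The correction terms $C\{\cdot\}$ vanish unless the node is irregular (i.e. the nodes in the finite difference stencil are not all on the same side of $\Gamma$). At an irregular node $X$ (the point at which the term is indexed), each is the sum of the following contributions over the stencil points $Y$ lying on the other side of $\Gamma$ from $X$. Let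 $z$ be the intersection point of $\Gamma$ with the horizontal or vertical segment $XY$, let $\partial$ denote $\partial_x$ (horizontal segment) or $\partial_y$ (vertical segment), let $\xi$ be the signed coordinate difference $Y-z$ along the segment, and take all jumps at $z$ (they are the jumps of the exact solution and its derivatives, and are determined by the problem data). If $X\in\Omega^+$: - $C\{\Delta u^{(k)}\}_X$: for each of the four neighbours $Y$ of $X$ at distance $h$ across $\Gamma$, contribution $\frac1{h^2}\big([\![u^{(k)}]\!]+\xi[\![\partial u^{(k)}]\!]+\frac12\xi^2[\![\partial^2u^{(k)}]\!]\big)$; - $C\{p_x\}_X$ (resp. $C\{p_y\}_X$): for the pressure node $Y$ at distance $h/2$ to the right (resp. above) of $X$ across $\Gamma$, contribution $-\frac1h([\![p]\!]+\xi[\![\partial p]\!])$; for the one to the left (resp. below), contribution $+\frac1h([\![p]\!]+\xi[\![\partial p]\!])$; - $C\{u^{(1)}_x\}_X$ (resp. $C\{u^{(2)}_y\}_X$): for the $u^{(1)}$-node (resp. $u^{(2)}$-node) $Y$ at distance $h/2$ to the left (resp. below) of $X$ across $\Gamma$, contribution $+\frac1h([\![u^{(k)}]\!]+\xi[\![\partial u^{(k)}]\!]+\frac12\xi^2[\![\partial^2u^{(k)}]\!])$ with $k=1$ (resp. $k=2$); for the one to the right (resp. above), the same expression with prefactor $-\frac1h$. If $X\in\Omega^-$ every contribution is negated. **Auxiliary functions.** $\widetilde u^{(k)}(x,y,h)=u^{(k)}(x,y)+h^2\hat u^{(k)}(x,y)$ ($k=1,2$), $\widetilde p(x,y,h)=p(x,y)+h^2\hat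 p(x,y)$, where $\hat u^{(1)},\hat u^{(2)},\hat p$ and their derivatives are bounded in terms of the exact solution, and such that: (a) with nodal values at the respective nodes, $\widetilde u^{(1)},\widetilde u^{(2)},\widetilde p$ satisfy the three equations of the modified MAC scheme with right-hand sides $\tilde f^{(1)}+\widetilde R^{(1)}$, $\tilde f^{(2)}+\widetilde R^{(2)}$, $\tilde g+\widetilde R$, where $|\widetilde R^{(k)}|\le Ch^2(\|u^{(k)}\|_{4,\infty}+\|p\|_{3,\infty})$ ($k=1,2$) and $|\widetilde R|\le Ch^2(\|u^{(1)}\|_{3,\infty}+\|u^{(2)}\|_{3,\infty})$ with $C$ independent of $h$; (b) $\widetilde u^{(1)}(x,-\frac h2)=-\widetilde u^{(1)}(x,\frac h2)+\mathcal O(h^4)$, $\widetilde u^{(1)}(x,1-\frac h2)=-\widetilde u^{(1)}(x,1+\frac h2)+\mathcal O(h^4)$, $\widetilde u^{(2)}(-\frac h2,y)=-\widetilde u^{(2)}(\frac h2,y)+\mathcal O(h^4)$, $\widetilde u^{(2)}(1-\frac h2,y)=-\widetilde u^{(2)}(1+\frac h2,y)+\mathcal O(h^4)$, and $\widetilde u^{(1)}(0,y)=\widetilde u^{(1)}(1,y)=\widetilde u^{(2)}(x,0)=\widetilde u^{(2)}(x,1)=0$. Such functions exist when the exact solution is sufficiently smooth away from $\Gamma$. As in the claim, the errors are taken as elements of $V_h^{(1)}$, $V_h^{(2)}$, $M_h$: ghost values are given by the reflection rules of these spaces, and the additive constant in the pressure is normalized so that $\widetilde e_p$ has zero discrete sum.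 *)

theory Defs
  imports "HOL-Analysis.Analysis"
begin

type_synonym pt = "real \<times> real"

subsection \<open>Partial derivatives, piecewise smoothness, jumps\<close>

definition dx :: "(pt \<Rightarrow> real) \<Rightarrow> pt \<Rightarrow> real" where
  "dx v X = deriv (\<lambda>t. v (t, snd X)) (fst X)"

definition dy :: "(pt \<Rightarrow> real) \<Rightarrow> pt \<Rightarrow> real" where
  "dy v X = deriv (\<lambda>t. v (fst X, t)) (snd X)"

definition pd :: "nat \<Rightarrow> nat \<Rightarrow> (pt \<Rightarrow> real) \<Rightarrow> pt \<Rightarrow> real" where
  "pd s l v = (dx ^^ s) ((dy ^^ l) v)"

primrec Ck_on :: "nat \<Rightarrow> pt set \<Rightarrow> (pt \<Rightarrow> real) \<Rightarrow> bool" where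
  "Ck_on 0 S v = continuous_on S v"
| "Ck_on (Suc k) S v =
    ((\<forall>X\<in>S. (\<lambda>t. v (t, snd X)) differentiable (at (fst X)) \<and>
            (\<lambda>t. v (fst X, t)) differentiable (at (snd X))) \<and>
     continuous_on S v \<and> Ck_on k S (dx v) \<and> Ck_on k S (dy v))"

definition Omega :: "pt set" where
  "Omega = {0<..<1} \<times> {0<..<1}"

text \<open>Throughout, \<open>\<Omega>p\<close> is the inner domain \<open>\<Omega>\<^sup>+\<close> and the interface is \<open>frontier \<Omega>p\<close>.\<close>

definition Omega_minus :: "pt set \<Rightarrow> pt set" where
  "Omega_minus \<Omega>p = Omega - closure \<Omega>p"

text \<open>The functions of the problem are two-sided, with no preferred value on the interface. Here they
  are total functions that carry on the interface their limit from \<open>\<Omega>p\<close> (the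
  \<open>continuous_on\<close> clause); a grid node lying on the interface is accordingly counted with
  \<open>\<Omega>p\<close>, see \<open>across\<close> and \<open>side_sign\<close>. Derivatives are only taken off the interface.
  Values outside the closed unit square are those of an extension, used at ghost nodes;
  no regularity is demanded of it.\<close>

definition pw_smooth :: "pt set \<Rightarrow> nat \<Rightarrow> (pt \<Rightarrow> real) \<Rightarrow> bool" where
  "pw_smooth \<Omega>p k v \<longleftrightarrow>
     Ck_on k (\<Omega>p \<union> Omega_minus \<Omega>p) v \<and>
     (\<forall>s l. s + l \<le> k \<longrightarrow>
        bounded (pd s l v ` (\<Omega>p \<union> Omega_minus \<Omega>p)) \<and>
        (\<forall>z\<in>frontier \<Omega>p.
           (\<exists>a. (pd s l v \<longlongrightarrow> a) (at z within \<Omega>p)) \<and>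
           (\<exists>b. (pd s l v \<longlongrightarrow> b) (at z within Omega_minus \<Omega>p)))) \<and>
     continuous_on (closure \<Omega>p) v"

definition sup_norm :: "pt set \<Rightarrow> nat \<Rightarrow> (pt \<Rightarrow> real) \<Rightarrow> real" where
  "sup_norm \<Omega>p r v =
     Sup {\<bar>pd s l v X\<bar> | s l X. s + l \<le> r \<and> X \<in> \<Omega>p \<union> Omega_minus \<Omega>p}"

definition sup_norm_vec :: "pt set \<Rightarrow> nat \<Rightarrow> (pt \<Rightarrow> real) \<Rightarrow> (pt \<Rightarrow> real) \<Rightarrow> real" where
  "sup_norm_vec \<Omega>p r v1 v2 = max (sup_norm \<Omega>p r v1) (sup_norm \<Omega>p r v2)"

definition jump :: "pt set \<Rightarrow> (pt \<Rightarrow> 'b::real_normed_vector) \<Rightarrow> pt \<Rightarrow> 'b" where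
  "jump \<Omega>p v z = Lim (at z within \<Omega>p) v - Lim (at z within Omega_minus \<Omega>p) v"

subsection \<open>The interface problem\<close>

definition grad :: "(pt \<Rightarrow> real) \<Rightarrow> pt \<Rightarrow> pt" where
  "grad \<phi> X = (dx \<phi> X, dy \<phi> X)"

definition local_defining_function :: "pt set \<Rightarrow> pt \<Rightarrow> pt set \<Rightarrow> (pt \<Rightarrow> real) \<Rightarrow> bool" where
  "local_defining_function \<Omega>p z U \<phi> \<longleftrightarrow>
     open U \<and> z \<in> U \<and> (\<forall>k. Ck_on k U \<phi>) \<and> (\<forall>X\<in>U. grad \<phi> X \<noteq> 0) \<and>
     \<Omega>p \<inter> U = {X \<in> U. \<phi> X < 0} \<and> frontier \<Omega>p \<inter> U = {X \<in> U. \<phi> X = 0}"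

definition smooth_boundary :: "pt set \<Rightarrow> bool" where
  "smooth_boundary \<Omega>p \<longleftrightarrow> (\<forall>z\<in>frontier \<Omega>p. \<exists>U \<phi>. local_defining_function \<Omega>p z U \<phi>)"

text \<open>The choice is unique: the normalised gradient does not depend on the defining function.
  It points out of \<open>\<Omega>p\<close> since the defining function is negative there.\<close>

definition unit_normal :: "pt set \<Rightarrow> pt \<Rightarrow> pt" where
  "unit_normal \<Omega>p z =
     (SOME \<nu>. \<exists>U \<phi>. local_defining_function \<Omega>p z U \<phi> \<and> \<nu> = grad \<phi> z /\<^sub>R norm (grad \<phi> z))"

definition interface_domain :: "pt set \<Rightarrow> bool" where
  "interface_domain \<Omega>p \<longleftrightarrow>
     open \<Omega>p \<and> \<Omega>p \<noteq> {} \<and> closure \<Omega>p \<subseteq> Omega \<and> simply_connected \<Omega>p \<and> smooth_boundary \<Omega>p"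

text \<open>The vector \<open>\<sigma>(u,p) n = (-p I + \<nabla>u + (\<nabla>u)\<^sup>T) n\<close> at the point \<open>X\<close>, for a fixed vector \<open>n\<close>.\<close>

definition traction ::
  "(pt \<Rightarrow> real) \<Rightarrow> (pt \<Rightarrow> real) \<Rightarrow> (pt \<Rightarrow> real) \<Rightarrow> pt \<Rightarrow> pt \<Rightarrow> pt" where
  "traction u1 u2 p n X =
     ((- p X + 2 * dx u1 X) * fst n + (dy u1 X + dx u2 X) * snd n,
      (dx u2 X + dy u1 X) * fst n + (- p X + 2 * dy u2 X) * snd n)"

definition stokes_interface_solution ::
  "pt set \<Rightarrow> (pt \<Rightarrow> real) \<Rightarrow> (pt \<Rightarrow> real) \<Rightarrow> (pt \<Rightarrow> pt) \<Rightarrow>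
   (pt \<Rightarrow> real) \<Rightarrow> (pt \<Rightarrow> real) \<Rightarrow> (pt \<Rightarrow> real) \<Rightarrow> bool" where
  "stokes_interface_solution \<Omega>p f1 f2 \<psi> u1 u2 p \<longleftrightarrow>
     (\<forall>X \<in> \<Omega>p \<union> Omega_minus \<Omega>p.
        - (dx (dx u1) X + dy (dy u1) X) + dx p X = f1 X \<and>
        - (dx (dx u2) X + dy (dy u2) X) + dy p X = f2 X \<and>
        dx u1 X + dy u2 X = 0) \<and>
     (\<forall>z\<in>frontier \<Omega>p.
        jump \<Omega>p u1 z = 0 \<and> jump \<Omega>p u2 z = 0 \<and>
        jump \<Omega>p (traction u1 u2 p (unit_normal \<Omega>p z)) z = \<psi> z \<and>
        (f1 \<longlongrightarrow> f1 z) (at z within \<Omega>p) \<and> (f2 \<longlongrightarrow> f2 z) (at z within \<Omega>p)) \<and>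
     continuous_on (closure Omega - frontier \<Omega>p) u1 \<and>
     continuous_on (closure Omega - frontier \<Omega>p) u2 \<and>
     (\<forall>X\<in>frontier Omega. u1 X = 0 \<and> u2 X = 0)"

subsection \<open>Staggered grid, discrete spaces and norms\<close>

text \<open>A grid function is stored with the integer indices \<open>(i,j)\<close>, with these meanings:
  first velocity component \<open>v i j = v\<^bsub>i,j-1/2\<^esub>\<close> (node \<open>node_u1\<close>),
  second velocity component \<open>v i j = v\<^bsub>i-1/2,j\<^esub>\<close> (node \<open>node_u2\<close>),
  pressure \<open>q i j = q\<^bsub>i-1/2,j-1/2\<^esub>\<close> (node \<open>node_p\<close>), vertex function \<open>w i j = w\<^bsub>i,j\<^esub>\<close>.
  Ghost values sit at index \<open>0\<close> and \<open>N+1\<close> of the half-integer direction.\<close>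

type_synonym gridfun = "int \<Rightarrow> int \<Rightarrow> real"

definition node_u1 :: "real \<Rightarrow> int \<Rightarrow> int \<Rightarrow> pt" where
  "node_u1 h i j = (of_int i * h, (of_int j - 1/2) * h)"

definition node_u2 :: "real \<Rightarrow> int \<Rightarrow> int \<Rightarrow> pt" where
  "node_u2 h i j = ((of_int i - 1/2) * h, of_int j * h)"

definition node_p :: "real \<Rightarrow> int \<Rightarrow> int \<Rightarrow> pt" where
  "node_p h i j = ((of_int i - 1/2) * h, (of_int j - 1/2) * h)"

definition cell_edges :: "real \<Rightarrow> int \<Rightarrow> int \<Rightarrow> pt set set" where
  "cell_edges h i j =
     (let a = (of_int i - 1) * h; b = of_int i * h; c = (of_int j - 1) * h; d = of_int j * h in
      {closed_segment (a, c) (b, c), closed_segment (a, d) (b, d),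
       closed_segment (a, c) (a, d), closed_segment (b, c) (b, d)})"

definition fine_grid :: "pt set \<Rightarrow> nat \<Rightarrow> bool" where
  "fine_grid \<Omega>p N \<longleftrightarrow> N > 0 \<and>
     (\<forall>i\<in>{1..int N}. \<forall>j\<in>{1..int N}.
        (\<forall>E\<in>cell_edges (1 / real N) i j.
           E \<subseteq> frontier \<Omega>p \<or> (finite (E \<inter> frontier \<Omega>p) \<and> card (E \<inter> frontier \<Omega>p) \<le> 2)) \<and>
        (\<forall>a b. a \<noteq> b \<and> \<Union>(cell_edges (1 / real N) i j) \<inter> frontier \<Omega>p = {a, b} \<longrightarrow>
           (\<exists>E\<in>cell_edges (1 / real N) i j. \<exists>E'\<in>cell_edges (1 / real N) i j.
              E \<noteq> E' \<and> a \<in> E \<and> b \<in> E')))"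

definition dplus1 :: "real \<Rightarrow> gridfun \<Rightarrow> gridfun" where
  "dplus1 h v l m = (v (l + 1) m - v l m) / h"

definition dminus1 :: "real \<Rightarrow> gridfun \<Rightarrow> gridfun" where
  "dminus1 h v l m = (v l m - v (l - 1) m) / h"

definition dplus2 :: "real \<Rightarrow> gridfun \<Rightarrow> gridfun" where
  "dplus2 h v l m = (v l (m + 1) - v l m) / h"

definition dminus2 :: "real \<Rightarrow> gridfun \<Rightarrow> gridfun" where
  "dminus2 h v l m = (v l m - v l (m - 1)) / h"

definition lap_h :: "real \<Rightarrow> gridfun \<Rightarrow> gridfun" where
  "lap_h h v l m = dplus1 h (dminus1 h v) l m + dplus2 h (dminus2 h v) l m"

definition V1 :: "nat \<Rightarrow> gridfun set" where
  "V1 N = {v. (\<forall>j\<in>{0..int N + 1}. v 0 j = 0 \<and> v (int N) j = 0) \<and>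
              (\<forall>i\<in>{0..int N}. v i 0 = - v i 1 \<and> v i (int N + 1) = - v i (int N))}"

definition V2 :: "nat \<Rightarrow> gridfun set" where
  "V2 N = {v. (\<forall>i\<in>{0..int N + 1}. v i 0 = 0 \<and> v i (int N) = 0) \<and>
              (\<forall>j\<in>{0..int N}. v 0 j = - v 1 j \<and> v (int N + 1) j = - v (int N) j)}"

definition M_h :: "nat \<Rightarrow> gridfun set" where
  "M_h N = {q. (\<Sum>i=1..int N. \<Sum>j=1..int N. q i j) = 0}"

definition norm_V1 :: "nat \<Rightarrow> gridfun \<Rightarrow> real" where
  "norm_V1 N v = sqrt ((1 / real N)\<^sup>2 * (\<Sum>i=1..int N - 1. \<Sum>j=1..int N. (v i j)\<^sup>2))"

definition norm_V2 :: "nat \<Rightarrow> gridfun \<Rightarrow> real" where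
  "norm_V2 N v = sqrt ((1 / real N)\<^sup>2 * (\<Sum>i=1..int N. \<Sum>j=1..int N - 1. (v i j)\<^sup>2))"

definition norm_M :: "nat \<Rightarrow> gridfun \<Rightarrow> real" where
  "norm_M N q = sqrt ((1 / real N)\<^sup>2 * (\<Sum>i=1..int N. \<Sum>j=1..int N. (q i j)\<^sup>2))"

definition rho :: "nat \<Rightarrow> int \<Rightarrow> real" where
  "rho N k = (if k = 0 \<or> k = int N then 1/2 else 1)"

definition norm_W1 :: "nat \<Rightarrow> gridfun \<Rightarrow> real" where
  "norm_W1 N w = sqrt ((1 / real N)\<^sup>2 * (\<Sum>i=1..int N - 1. \<Sum>j=0..int N. rho N j * (w i j)\<^sup>2))"

definition norm_W2 :: "nat \<Rightarrow> gridfun \<Rightarrow> real" where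
  "norm_W2 N w = sqrt ((1 / real N)\<^sup>2 * (\<Sum>i=0..int N. \<Sum>j=1..int N - 1. rho N i * (w i j)\<^sup>2))"

definition norm_V :: "nat \<Rightarrow> gridfun \<Rightarrow> gridfun \<Rightarrow> real" where
  "norm_V N v1 v2 = sqrt ((norm_V1 N v1)\<^sup>2 + (norm_V2 N v2)\<^sup>2)"

text \<open>The quotient at the vertex \<open>(i,j)\<close>, \<open>h\<^sup>-\<^sup>1(v\<^bsub>i,j+1/2\<^esub> - v\<^bsub>i,j-1/2\<^esub>)\<close>, is
  \<open>(v i (j+1) - v i j) / h\<close> in the index encoding above, hence \<open>dplus2\<close> (resp. \<open>dplus1\<close>)
  in the two vertex terms.\<close>

definition seminorm_H1 :: "nat \<Rightarrow> gridfun \<Rightarrow> gridfun \<Rightarrow> real" where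
  "seminorm_H1 N v1 v2 =
     sqrt ((norm_M N (dminus1 (1 / real N) v1))\<^sup>2 + (norm_W1 N (dplus2 (1 / real N) v1))\<^sup>2 +
           (norm_W2 N (dplus1 (1 / real N) v2))\<^sup>2 + (norm_M N (dminus2 (1 / real N) v2))\<^sup>2)"

subsection \<open>Correction terms and the modified MAC scheme\<close>

definition across :: "pt set \<Rightarrow> pt \<Rightarrow> pt \<Rightarrow> bool" where
  "across \<Omega>p X Y \<longleftrightarrow> (X \<in> closure \<Omega>p) \<noteq> (Y \<in> closure \<Omega>p)"

definition side_sign :: "pt set \<Rightarrow> pt \<Rightarrow> real" where
  "side_sign \<Omega>p X = (if X \<in> closure \<Omega>p then 1 else - 1)"

text \<open>On a sufficiently fine grid a stencil segment meets the interface only once, so that no choice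
  is involved; in general this is some intersection point.\<close>

definition crossing :: "pt set \<Rightarrow> pt \<Rightarrow> pt \<Rightarrow> pt" where
  "crossing \<Omega>p X Y = (SOME z. z \<in> frontier \<Omega>p \<and> z \<in> closed_segment X Y)"

text \<open>\<open>jump_taylor_x \<Omega>p m v X d\<close> is \<open>[v] + \<xi> [\<partial>v] + \<dots> + \<xi>\<^sup>m/m! [\<partial>\<^sup>m v]\<close> for the stencil point at
  signed horizontal distance \<open>d\<close> from \<open>X\<close>, and \<open>0\<close> if that point is on the side of \<open>X\<close>.
  The prefactors and the sign for the side of \<open>X\<close> are in the \<open>corr\<close> definitions.\<close>

definition jump_taylor_x :: "pt set \<Rightarrow> nat \<Rightarrow> (pt \<Rightarrow> real) \<Rightarrow> pt \<Rightarrow> real \<Rightarrow> real" where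
  "jump_taylor_x \<Omega>p m v X d =
     (let Y = (fst X + d, snd X); z = crossing \<Omega>p X Y; \<xi> = fst Y - fst z in
      if across \<Omega>p X Y then (\<Sum>n\<le>m. \<xi> ^ n / fact n * jump \<Omega>p ((dx ^^ n) v) z) else 0)"

definition jump_taylor_y :: "pt set \<Rightarrow> nat \<Rightarrow> (pt \<Rightarrow> real) \<Rightarrow> pt \<Rightarrow> real \<Rightarrow> real" where
  "jump_taylor_y \<Omega>p m v X d =
     (let Y = (fst X, snd X + d); z = crossing \<Omega>p X Y; \<xi> = snd Y - snd z in
      if across \<Omega>p X Y then (\<Sum>n\<le>m. \<xi> ^ n / fact n * jump \<Omega>p ((dy ^^ n) v) z) else 0)"

definition corr_lap :: "pt set \<Rightarrow> real \<Rightarrow> (pt \<Rightarrow> real) \<Rightarrow> pt \<Rightarrow> real" where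
  "corr_lap \<Omega>p h u X = side_sign \<Omega>p X * (1 / h\<^sup>2) *
     (jump_taylor_x \<Omega>p 2 u X h + jump_taylor_x \<Omega>p 2 u X (- h) +
      jump_taylor_y \<Omega>p 2 u X h + jump_taylor_y \<Omega>p 2 u X (- h))"

definition corr_px :: "pt set \<Rightarrow> real \<Rightarrow> (pt \<Rightarrow> real) \<Rightarrow> pt \<Rightarrow> real" where
  "corr_px \<Omega>p h p X = side_sign \<Omega>p X *
     (- (1 / h) * jump_taylor_x \<Omega>p 1 p X (h / 2) + (1 / h) * jump_taylor_x \<Omega>p 1 p X (- h / 2))"

definition corr_py :: "pt set \<Rightarrow> real \<Rightarrow> (pt \<Rightarrow> real) \<Rightarrow> pt \<Rightarrow> real" where
  "corr_py \<Omega>p h p X = side_sign \<Omega>p X *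
     (- (1 / h) * jump_taylor_y \<Omega>p 1 p X (h / 2) + (1 / h) * jump_taylor_y \<Omega>p 1 p X (- h / 2))"

definition corr_ux :: "pt set \<Rightarrow> real \<Rightarrow> (pt \<Rightarrow> real) \<Rightarrow> pt \<Rightarrow> real" where
  "corr_ux \<Omega>p h u X = side_sign \<Omega>p X *
     ((1 / h) * jump_taylor_x \<Omega>p 2 u X (- h / 2) - (1 / h) * jump_taylor_x \<Omega>p 2 u X (h / 2))"

definition corr_uy :: "pt set \<Rightarrow> real \<Rightarrow> (pt \<Rightarrow> real) \<Rightarrow> pt \<Rightarrow> real" where
  "corr_uy \<Omega>p h u X = side_sign \<Omega>p X *
     ((1 / h) * jump_taylor_y \<Omega>p 2 u X (- h / 2) - (1 / h) * jump_taylor_y \<Omega>p 2 u X (h / 2))"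

definition rhs1 ::
  "pt set \<Rightarrow> real \<Rightarrow> (pt \<Rightarrow> real) \<Rightarrow> (pt \<Rightarrow> real) \<Rightarrow> (pt \<Rightarrow> real) \<Rightarrow> gridfun" where
  "rhs1 \<Omega>p h f1 u1 p i j =
     (let X = node_u1 h i j in f1 X + corr_lap \<Omega>p h u1 X + corr_px \<Omega>p h p X)"

definition rhs2 ::
  "pt set \<Rightarrow> real \<Rightarrow> (pt \<Rightarrow> real) \<Rightarrow> (pt \<Rightarrow> real) \<Rightarrow> (pt \<Rightarrow> real) \<Rightarrow> gridfun" where
  "rhs2 \<Omega>p h f2 u2 p i j =
     (let X = node_u2 h i j in f2 X + corr_lap \<Omega>p h u2 X + corr_py \<Omega>p h p X)"

definition rhs_div ::
  "pt set \<Rightarrow> real \<Rightarrow> (pt \<Rightarrow> real) \<Rightarrow> (pt \<Rightarrow> real) \<Rightarrow> gridfun" where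
  "rhs_div \<Omega>p h u1 u2 i j =
     (let X = node_p h i j in corr_ux \<Omega>p h u1 X + corr_uy \<Omega>p h u2 X)"

definition mac_equations ::
  "nat \<Rightarrow> gridfun \<Rightarrow> gridfun \<Rightarrow> gridfun \<Rightarrow> gridfun \<Rightarrow> gridfun \<Rightarrow> gridfun \<Rightarrow> bool" where
  "mac_equations N F1 F2 G v1 v2 q \<longleftrightarrow>
     (let h = 1 / real N in
      (\<forall>i\<in>{1..int N - 1}. \<forall>j\<in>{1..int N}. - lap_h h v1 i j + dplus1 h q i j = F1 i j) \<and>
      (\<forall>i\<in>{1..int N}. \<forall>j\<in>{1..int N - 1}. - lap_h h v2 i j + dplus2 h q i j = F2 i j) \<and>
      (\<forall>i\<in>{1..int N}. \<forall>j\<in>{1..int N}. dminus1 h v1 i j + dminus2 h v2 i j = G i j))"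

definition modified_mac_solution ::
  "pt set \<Rightarrow> nat \<Rightarrow> (pt \<Rightarrow> real) \<Rightarrow> (pt \<Rightarrow> real) \<Rightarrow>
   (pt \<Rightarrow> real) \<Rightarrow> (pt \<Rightarrow> real) \<Rightarrow> (pt \<Rightarrow> real) \<Rightarrow> gridfun \<Rightarrow> gridfun \<Rightarrow> gridfun \<Rightarrow> bool" where
  "modified_mac_solution \<Omega>p N f1 f2 u1 u2 p v1 v2 q \<longleftrightarrow>
     v1 \<in> V1 N \<and> v2 \<in> V2 N \<and> q \<in> M_h N \<and>
     mac_equations N (rhs1 \<Omega>p (1 / real N) f1 u1 p) (rhs2 \<Omega>p (1 / real N) f2 u2 p)
       (rhs_div \<Omega>p (1 / real N) u1 u2) v1 v2 q"

subsection \<open>Auxiliary functions and errors\<close>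

definition perturbed :: "(pt \<Rightarrow> real) \<Rightarrow> (pt \<Rightarrow> real) \<Rightarrow> real \<Rightarrow> pt \<Rightarrow> real" where
  "perturbed v v_hat h X = v X + h\<^sup>2 * v_hat X"

text \<open>\<open>K\<close> is a common bound for all constants hidden in the description of the auxiliary functions:
  the bound on the functions marked by a hat and their derivatives up to order \<open>r\<close> (in terms of
  the derivatives of the exact velocity up to order \<open>k\<close> and of the pressure up to order \<open>k - 1\<close>),
  the constant in the bounds on the residuals, and the constant in \<open>O(h\<^sup>4)\<close>.\<close>

definition auxiliary_functions ::
  "pt set \<Rightarrow> nat \<Rightarrow> nat \<Rightarrow> real \<Rightarrow> (pt \<Rightarrow> real) \<Rightarrow> (pt \<Rightarrow> real) \<Rightarrow>
   (pt \<Rightarrow> real) \<Rightarrow> (pt \<Rightarrow> real) \<Rightarrow> (pt \<Rightarrow> real) \<Rightarrow>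
   (pt \<Rightarrow> real) \<Rightarrow> (pt \<Rightarrow> real) \<Rightarrow> (pt \<Rightarrow> real) \<Rightarrow> bool" where
  "auxiliary_functions \<Omega>p k r K f1 f2 u1 u2 p u1_hat u2_hat p_hat \<longleftrightarrow>
     (\<forall>w\<in>{u1_hat, u2_hat, p_hat}.
        pw_smooth \<Omega>p r w \<and>
        sup_norm \<Omega>p r w \<le> K * (sup_norm_vec \<Omega>p k u1 u2 + sup_norm \<Omega>p (k - 1) p)) \<and>
     (\<forall>N. fine_grid \<Omega>p N \<longrightarrow>
        (let h = 1 / real N;
             u1t = perturbed u1 u1_hat h; u2t = perturbed u2 u2_hat h; pt = perturbed p p_hat h;
             S = sup_norm_vec \<Omega>p 4 u1 u2 + sup_norm \<Omega>p 3 p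
         in
         (\<exists>R1 R2 R :: gridfun.
            mac_equations N
              (\<lambda>i j. rhs1 \<Omega>p h f1 u1 p i j + R1 i j)
              (\<lambda>i j. rhs2 \<Omega>p h f2 u2 p i j + R2 i j)
              (\<lambda>i j. rhs_div \<Omega>p h u1 u2 i j + R i j)
              (\<lambda>i j. u1t (node_u1 h i j)) (\<lambda>i j. u2t (node_u2 h i j)) (\<lambda>i j. pt (node_p h i j)) \<and>
            (\<forall>i\<in>{1..int N - 1}. \<forall>j\<in>{1..int N}.
               \<bar>R1 i j\<bar> \<le> K * h\<^sup>2 * (sup_norm \<Omega>p 4 u1 + sup_norm \<Omega>p 3 p)) \<and>
            (\<forall>i\<in>{1..int N}. \<forall>j\<in>{1..int N - 1}.
               \<bar>R2 i j\<bar> \<le> K * h\<^sup>2 * (sup_norm \<Omega>p 4 u2 + sup_norm \<Omega>p 3 p)) \<and>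
            (\<forall>i\<in>{1..int N}. \<forall>j\<in>{1..int N}.
               \<bar>R i j\<bar> \<le> K * h\<^sup>2 * (sup_norm \<Omega>p 3 u1 + sup_norm \<Omega>p 3 u2))) \<and>
         (\<forall>x\<in>{0..1}.
            \<bar>u1t (x, - h / 2) + u1t (x, h / 2)\<bar> \<le> K * h ^ 4 * S \<and>
            \<bar>u1t (x, 1 - h / 2) + u1t (x, 1 + h / 2)\<bar> \<le> K * h ^ 4 * S \<and>
            u2t (x, 0) = 0 \<and> u2t (x, 1) = 0) \<and>
         (\<forall>y\<in>{0..1}.
            \<bar>u2t (- h / 2, y) + u2t (h / 2, y)\<bar> \<le> K * h ^ 4 * S \<and>
            \<bar>u2t (1 - h / 2, y) + u2t (1 + h / 2, y)\<bar> \<le> K * h ^ 4 * S \<and>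
            u1t (0, y) = 0 \<and> u1t (1, y) = 0)))"

text \<open>Errors as elements of the discrete spaces: ghost values by reflection, pressure error
  shifted by a constant to discrete mean zero.\<close>

definition err_u1 :: "nat \<Rightarrow> gridfun \<Rightarrow> (pt \<Rightarrow> real) \<Rightarrow> gridfun" where
  "err_u1 N v ut i j =
     (let e = (\<lambda>i j. v i j - ut (node_u1 (1 / real N) i j)) in
      if j = 0 then - e i 1 else if j = int N + 1 then - e i (int N) else e i j)"

definition err_u2 :: "nat \<Rightarrow> gridfun \<Rightarrow> (pt \<Rightarrow> real) \<Rightarrow> gridfun" where
  "err_u2 N v ut i j =
     (let e = (\<lambda>i j. v i j - ut (node_u2 (1 / real N) i j)) in
      if i = 0 then - e 1 j else if i = int N + 1 then - e (int N) j else e i j)"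

definition err_p :: "nat \<Rightarrow> gridfun \<Rightarrow> (pt \<Rightarrow> real) \<Rightarrow> gridfun" where
  "err_p N q pt i j =
     (let e = (\<lambda>i j. q i j - pt (node_p (1 / real N) i j)) in
      e i j - (\<Sum>k=1..int N. \<Sum>l=1..int N. e k l) / (real N)\<^sup>2)"

end

(* The errors solve the discrete Stokes equations with data of size O(h^2): the residuals, plus the
   O(h^4) mismatch of the ghost values divided by h^2. It remains to prove that the MAC scheme is
   stable uniformly in h, and this is done without constructing a right inverse of the discrete
   divergence. On the staggered grid the discrete Laplacian is grad div - curl' curl, so
   P = p - div u satisfies grad P = f - curl' w, where w = curl u. Let d be the distance to the
   boundary of the square. A weighted Poincare inequality bounds the L2 norm of the mean-free P by
   that of d grad P. Since grad and curl' are orthogonal on functions vanishing at the boundary,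
   testing with d^2 w (Caccioppoli) bounds d curl' w, hence also d grad P, by f and w. So the
   pressure is bounded by the data and the energy seminorm of u, and the energy identity closes the
   estimate. *)

theory Submission
  imports Defs
begin

text \<open>Uniform stability requires control of the pressure by the velocity. The obstacle is that
  the no-slip condition leaves the vorticity free on the boundary, so \<open>w\<close> itself is not
  an admissible test function in the orthogonality of \<open>grad\<close> and \<open>curl'\<close>.
  The factor \<open>d^2\<close> makes it admissible. Since \<open>d\<close> is Lipschitz,
  differencing the cutoff costs only undifferenced vorticity, which the energy controls. The price
  is a weight that degenerates at the boundary. The Poincare inequality tolerates it by combining a
  Hardy-type bound near the boundary with lattice paths in a core where \<open>d\<close> is
  comparable to the side.

  The argument is not circular: in the energy identity the pressure is multiplied by
  \<open>div u\<close>, which is data, so a small multiple of its square can be absorbed. The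
  correction terms stand on the right-hand sides of both systems and cancel in the
  difference.\<close>

subsection \<open>Summation by parts\<close>

text \<open>The boundary terms are kept because with reflected ghost values they contribute to the
  energy.\<close>

lemma sum_by_parts:
  fixes a b :: "int \<Rightarrow> real"
  assumes "1 \<le> n"
  shows "(\<Sum>i=1..n-1. (a (i+1) - a i) * b i) + (\<Sum>i=1..n. a i * (b i - b (i-1)))
         = a n * b n - a 1 * b 0"
  using assms
proof (induction n rule: int_ge_induct)
  case base
  then show ?case by (simp add: algebra_simps)
next
  case (step n)
  have *: "{1..n} = insert n {1..n-1}" "{1..n+1} = insert (n+1) {1..n}"
    using step.hyps by auto
  have "(\<Sum>i=1..n. (a (i+1) - a i) * b i) = (a (n+1) - a n) * b n + (\<Sum>i=1..n-1. (a (i+1) - a i) * b i)"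
    by (subst *(1)) simp
  moreover have "(\<Sum>i=1..n+1. a i * (b i - b (i-1))) = a (n+1) * (b (n+1) - b n) + (\<Sum>i=1..n. a i * (b i - b (i-1)))"
    by (subst *(2)) simp
  ultimately show ?case using step.IH by (simp add: algebra_simps)
qed

lemma sum_by_parts_0:
  fixes a b :: "int \<Rightarrow> real"
  assumes "1 \<le> n" "b 0 = 0" "b n = 0"
  shows "(\<Sum>i=1..n. a i * (b i - b (i-1))) = - (\<Sum>i=1..n-1. (a (i+1) - a i) * b i)"
  using sum_by_parts[OF assms(1), of a b] assms(2,3) by simp

lemma sum_pred_shift:
  fixes f :: "int \<Rightarrow> real"
  shows "(\<Sum>j=1..n. f (j-1)) = (\<Sum>j=0..n-1. f j)"
  by (rule sum.reindex_bij_witness[of _ "\<lambda>j. j+1" "\<lambda>j. j-1"]) auto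

lemma sum_succ_shift:
  fixes f :: "int \<Rightarrow> real"
  shows "(\<Sum>j=1..n-1. f (j+1)) = (\<Sum>j=2..n. f j)"
  by (rule sum.reindex_bij_witness[of _ "\<lambda>j. j-1" "\<lambda>j. j+1"]) auto

text \<open>Cauchy-Schwarz for the telescoping sum.\<close>

lemma sum_diff_square_le:
  fixes f :: "int \<Rightarrow> real"
  assumes "i \<le> k"
  shows "(f k - f i)\<^sup>2 \<le> of_int (k - i) * (\<Sum>s=i..k-1. (f (s+1) - f s)\<^sup>2)"
proof -
  have tele: "(\<Sum>s=i..k-1. (f (s+1) - f s)) = f k - f i"
    using assms
  proof (induction k rule: int_ge_induct)
    case (step k)
    have "{i..k} = insert k {i..k-1}" using step.hyps by auto
    then show ?case using step.IH by simp
  qed simp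
  have "(\<Sum>s=i..k-1. (f (s+1) - f s))\<^sup>2 \<le> of_nat (card {i..k-1}) * (\<Sum>s=i..k-1. (f (s+1) - f s)\<^sup>2)"
    using sum_squared_le_sum_of_squares[of "\<lambda>s. f (s+1) - f s" "{i..k-1}"]
    by (simp add: mult.commute)
  with tele assms show ?thesis by simp
qed

subsection \<open>A weighted Poincare inequality on the square\<close>

text \<open>Distance to the boundary of the square \<open>[0, 2n]\<^sup>2\<close>, i.e. in half mesh widths: cell centres
  have odd and vertices have even coordinates.\<close>

definition bdist :: "int \<Rightarrow> int \<Rightarrow> int \<Rightarrow> real" where
  "bdist n a b = of_int (n - max \<bar>a - n\<bar> \<bar>b - n\<bar>)"

lemma bdist_commute: "bdist n a b = bdist n b a"
  by (simp add: bdist_def max.commute)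

lemma bdist_le: "bdist n a b \<le> of_int n"
proof -
  have "n - max \<bar>a - n\<bar> \<bar>b - n\<bar> \<le> n" by (simp add: le_max_iff_disj)
  then show ?thesis unfolding bdist_def by (simp only: of_int_le_iff)
qed

definition wgrad1 :: "int \<Rightarrow> gridfun \<Rightarrow> real" where
  "wgrad1 n q = (\<Sum>j=1..n. \<Sum>i=1..n-1. (bdist n (2*i) (2*j-1))\<^sup>2 * (q (i+1) j - q i j)\<^sup>2)"

definition wgrad2 :: "int \<Rightarrow> gridfun \<Rightarrow> real" where
  "wgrad2 n q = (\<Sum>i=1..n. \<Sum>j=1..n-1. (bdist n (2*i-1) (2*j))\<^sup>2 * (q i (j+1) - q i j)\<^sup>2)"

text \<open>Off the diagonals the step of width 2 does not cross a kink of \<open>max\<close>, and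
  the values \<open>4 * \<bar>a\<bar>\<close> and \<open>2 * \<bar>b\<bar>\<close> are exact; on the
  diagonals their mean \<open>3 * \<bar>a\<bar>\<close> is still a lower bound.\<close>

lemma radial_div_aux:
  fixes a b :: int
  shows "(a+1) * max \<bar>a+1\<bar> \<bar>b\<bar> - (a-1) * max \<bar>a-1\<bar> \<bar>b\<bar>
    \<ge> (if \<bar>a\<bar> > \<bar>b\<bar> then 4 * \<bar>a\<bar> else if \<bar>a\<bar> < \<bar>b\<bar> then 2 * \<bar>b\<bar> else 3 * \<bar>a\<bar>)"
proof -
  consider "\<bar>a\<bar> > \<bar>b\<bar>" "a > 0" | "\<bar>a\<bar> > \<bar>b\<bar>" "a < 0" | "\<bar>a\<bar> < \<bar>b\<bar>" | "\<bar>a\<bar> = \<bar>b\<bar>" "a > 0"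
    | "\<bar>a\<bar> = \<bar>b\<bar>" "a < 0" | "a = 0" "b = 0" by linarith
  then show ?thesis
  proof cases
    case 1
    then have "max \<bar>a+1\<bar> \<bar>b\<bar> = a+1" "max \<bar>a-1\<bar> \<bar>b\<bar> = a-1" by auto
    then show ?thesis using 1 by (simp add: algebra_simps)
  next
    case 2
    then have "max \<bar>a+1\<bar> \<bar>b\<bar> = -(a+1)" "max \<bar>a-1\<bar> \<bar>b\<bar> = -(a-1)" by auto
    then show ?thesis using 2 by (simp add: algebra_simps)
  next
    case 3
    then have "max \<bar>a+1\<bar> \<bar>b\<bar> = \<bar>b\<bar>" "max \<bar>a-1\<bar> \<bar>b\<bar> = \<bar>b\<bar>" by auto
    then show ?thesis using 3 by (simp add: algebra_simps)
  next
    case 4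
    then have "max \<bar>a+1\<bar> \<bar>b\<bar> = a+1" "max \<bar>a-1\<bar> \<bar>b\<bar> = a" by auto
    then show ?thesis using 4 by (simp add: algebra_simps)
  next
    case 5
    then have "max \<bar>a+1\<bar> \<bar>b\<bar> = -a" "max \<bar>a-1\<bar> \<bar>b\<bar> = -(a-1)" by auto
    then show ?thesis using 5 by (simp add: algebra_simps)
  qed simp
qed

text \<open>The field \<open>X * |X|_max\<close> is homogeneous of degree 2, so by Euler's identity
  its divergence is \<open>3 * |X|_max\<close>; differences over width 2 double this.\<close>

lemma radial_div:
  fixes a b :: int
  shows "6 * max \<bar>a\<bar> \<bar>b\<bar> \<le> (a+1) * max \<bar>a+1\<bar> \<bar>b\<bar> - (a-1) * max \<bar>a-1\<bar> \<bar>b\<bar>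
    + ((b+1) * max \<bar>b+1\<bar> \<bar>a\<bar> - (b-1) * max \<bar>b-1\<bar> \<bar>a\<bar>)"
proof -
  have gen: "6 * max A B \<le> x + y"
    if "(if A > B then 4 * A else if A < B then 2 * B else 3 * A) \<le> x"
       "(if B > A then 4 * B else if B < A then 2 * A else 3 * B) \<le> y" for A B x y :: int
    using that by (auto simp: max_def split: if_splits)
  show ?thesis by (rule gen[OF radial_div_aux radial_div_aux])
qed

text \<open>First component of the field \<open>-(X - c) d(X)\<close>, where \<open>c\<close> is the centre and \<open>d\<close> the distance to the
  boundary; the second one is \<open>radial n b a\<close>. It vanishes on the boundary, yet its divergence is
  bounded below there, so that integrating \<open>q\<^sup>2\<close> against the divergence controls \<open>q\<close> near the
  boundary by \<open>d grad q\<close>.\<close>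

definition radial :: "int \<Rightarrow> int \<Rightarrow> int \<Rightarrow> real" where
  "radial n a b = - of_int (a - n) * bdist n a b"

lemma radial_divergence:
  "2 * of_int n - 6 * bdist n (2*i-1) (2*j-1) \<le>
     (radial n (2*i) (2*j-1) - radial n (2*(i-1)) (2*j-1)) +
     (radial n (2*j) (2*i-1) - radial n (2*(j-1)) (2*i-1))"
proof -
  define a b where "a = 2*i-1-n" and "b = 2*j-1-n"
  have shift: "2*i-n = a+1" "2*(i-1)-n = a-1" "2*j-n = b+1" "2*(j-1)-n = b-1"
    by (simp_all add: a_def b_def)
  have gen: "2 * real_of_int n - 6 * of_int (n - M) \<le>
     - of_int (a+1) * of_int (n - p) - - of_int (a-1) * of_int (n - q)
     + (- of_int (b+1) * of_int (n - r) - - of_int (b-1) * of_int (n - s))"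
    if "6 * M \<le> (a+1) * p - (a-1) * q + ((b+1) * r - (b-1) * s)" for M p q r s :: int
  proof -
    have "2*n - 6 * (n - M) \<le>
     - (a+1) * (n - p) - - (a-1) * (n - q) + (- (b+1) * (n - r) - - (b-1) * (n - s))"
      using that by (simp add: algebra_simps)
    then have "real_of_int (2*n - 6 * (n - M)) \<le> of_int
     (- (a+1) * (n - p) - - (a-1) * (n - q) + (- (b+1) * (n - r) - - (b-1) * (n - s)))"
      by (simp only: of_int_le_iff)
    then show ?thesis by simp
  qed
  show ?thesis
    unfolding radial_def bdist_def a_def[symmetric] b_def[symmetric] shift
    by (rule gen[OF radial_div])
qed

lemma sum_edge_ends_le:
  fixes f :: "int \<Rightarrow> real"
  assumes "\<And>i. 0 \<le> f i"
  shows "(\<Sum>i=1..n-1. f i + f (i+1)) \<le> 2 * (\<Sum>i=1..n. f i)"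
proof -
  have "(\<Sum>i=1..n-1. f i) \<le> (\<Sum>i=1..n. f i)" "(\<Sum>i=2..n. f i) \<le> (\<Sum>i=1..n. f i)"
    using assms by (auto intro!: sum_mono2)
  then show ?thesis by (simp add: sum.distrib sum_succ_shift)
qed

text \<open>One grid line of the integration by parts: the difference moves from \<open>Z\<close> to
  \<open>f^2\<close>, where it factors into a difference and a sum of neighbouring values.\<close>

lemma flux_bound:
  fixes f Z D :: "int \<Rightarrow> real"
  assumes n: "1 \<le> n" and Z: "Z 0 = 0" "Z n = 0"
    and ZD: "\<And>i. i \<in> {1..n-1} \<Longrightarrow> \<bar>Z i\<bar> \<le> of_int n * D i"
  shows "(\<Sum>i=1..n. (f i)\<^sup>2 * (Z i - Z (i-1))) \<le>
    2 * of_int n * (\<Sum>i=1..n-1. (D i)\<^sup>2 * (f (i+1) - f i)\<^sup>2) + of_int n / 2 * (\<Sum>i=1..n. (f i)\<^sup>2)"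
proof -
  have "- ((f (i+1))\<^sup>2 - (f i)\<^sup>2) * Z i \<le>
      of_int n * (2 * ((D i)\<^sup>2 * (f (i+1) - f i)\<^sup>2) + 1/4 * ((f i)\<^sup>2 + (f (i+1))\<^sup>2))"
    if i: "i \<in> {1..n-1}" for i
  proof -
    define x y where "x = D i * \<bar>f (i+1) - f i\<bar>" and "y = \<bar>f (i+1) + f i\<bar>"
    have "- ((f (i+1))\<^sup>2 - (f i)\<^sup>2) * Z i \<le> \<bar>Z i\<bar> * (\<bar>f (i+1) - f i\<bar> * \<bar>f (i+1) + f i\<bar>)"
    proof -
      have "- ((f (i+1))\<^sup>2 - (f i)\<^sup>2) * Z i = - (Z i * ((f (i+1) - f i) * (f (i+1) + f i)))"
        by (simp add: power2_eq_square algebra_simps)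
      also have "\<dots> \<le> \<bar>Z i * ((f (i+1) - f i) * (f (i+1) + f i))\<bar>" by (rule abs_ge_minus_self)
      finally show ?thesis by (simp only: abs_mult)
    qed
    also have "\<dots> \<le> of_int n * D i * (\<bar>f (i+1) - f i\<bar> * \<bar>f (i+1) + f i\<bar>)"
      using ZD[OF i] by (intro mult_right_mono) auto
    also have "\<dots> = of_int n * (x * y)" by (simp add: x_def y_def)
    \<comment> \<open>The weights are chosen so that each direction gives back \<open>n/2\<close>
      times the sum of squares: \<open>1/8\<close> times 2 from the bound on \<open>y^2\<close>,
      times 2 because every cell is an end of up to two edges.\<close>
    also have "x * y \<le> 2 * x\<^sup>2 + 1/8 * y\<^sup>2"
      using zero_le_power2[of "4*x - y"] by (simp add: power2_eq_square algebra_simps)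
    also have "y\<^sup>2 \<le> 2 * ((f i)\<^sup>2 + (f (i+1))\<^sup>2)"
      unfolding y_def using zero_le_power2[of "f (i+1) - f i"]
      by (simp add: power2_eq_square algebra_simps)
    also have "x\<^sup>2 = (D i)\<^sup>2 * (f (i+1) - f i)\<^sup>2"
      by (simp add: x_def power_mult_distrib)
    finally show ?thesis using n by (simp add: algebra_simps)
  qed
  then have "(\<Sum>i=1..n-1. - ((f (i+1))\<^sup>2 - (f i)\<^sup>2) * Z i) \<le>
    (\<Sum>i=1..n-1. of_int n * (2 * ((D i)\<^sup>2 * (f (i+1) - f i)\<^sup>2) + 1/4 * ((f i)\<^sup>2 + (f (i+1))\<^sup>2)))"
    by (rule sum_mono)
  also have "\<dots> = of_int n * (2 * (\<Sum>i=1..n-1. (D i)\<^sup>2 * (f (i+1) - f i)\<^sup>2)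
      + 1/4 * (\<Sum>i=1..n-1. (f i)\<^sup>2 + (f (i+1))\<^sup>2))"
    by (simp only: sum.distrib flip: sum_distrib_left)
  also have "\<dots> \<le> of_int n * (2 * (\<Sum>i=1..n-1. (D i)\<^sup>2 * (f (i+1) - f i)\<^sup>2)
      + 1/4 * (2 * (\<Sum>i=1..n. (f i)\<^sup>2)))"
    using n sum_edge_ends_le[of "\<lambda>i. (f i)\<^sup>2" n] by (intro mult_left_mono add_left_mono) auto
  also have "(\<Sum>i=1..n-1. - ((f (i+1))\<^sup>2 - (f i)\<^sup>2) * Z i) = (\<Sum>i=1..n. (f i)\<^sup>2 * (Z i - Z (i-1)))"
    using sum_by_parts_0[where a = "\<lambda>i. (f i)\<^sup>2" and b = Z, OF n Z]
    by (simp only: sum_negf mult_minus_left)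
  finally show ?thesis by (simp add: field_simps)
qed

text \<open>The squares are summed against the divergence of \<open>radial\<close>. The two
  directions of \<open>flux_bound\<close> together return half of the \<open>2 * n\<close> supplied
  by \<open>radial_divergence\<close>. The remaining term carries the factor \<open>bdist\<close>,
  so it is small exactly where the weight of the gradient degenerates.\<close>

lemma hardy_square:
  assumes n: "1 \<le> n"
  shows "of_int n * (\<Sum>i=1..n. \<Sum>j=1..n. (q i j)\<^sup>2) \<le>
    6 * (\<Sum>i=1..n. \<Sum>j=1..n. bdist n (2*i-1) (2*j-1) * (q i j)\<^sup>2)
    + 2 * of_int n * (wgrad1 n q + wgrad2 n q)"
proof -
  let ?Q = "\<Sum>i=1..n. \<Sum>j=1..n. (q i j)\<^sup>2"
  have Z: "radial n 0 b = 0" "radial n (2*n) b = 0" if "0 \<le> b" "b \<le> 2*n" for b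
    using that by (auto simp: radial_def bdist_def)
  have ZD: "\<bar>radial n (2*i) b\<bar> \<le> of_int n * bdist n (2*i) b" if "i \<in> {1..n-1}" "0 \<le> b" "b \<le> 2*n" for i b
  proof -
    have "\<bar>real_of_int (2*i-n)\<bar> \<le> of_int n" "0 \<le> bdist n (2*i) b"
      using that by (auto simp: bdist_def)
    then show ?thesis unfolding radial_def abs_mult by (simp add: mult_right_mono)
  qed
  have 1: "(\<Sum>i=1..n. (q i j)\<^sup>2 * (radial n (2*i) (2*j-1) - radial n (2*(i-1)) (2*j-1))) \<le>
      2 * of_int n * (\<Sum>i=1..n-1. (bdist n (2*i) (2*j-1))\<^sup>2 * (q (i+1) j - q i j)\<^sup>2)
      + of_int n / 2 * (\<Sum>i=1..n. (q i j)\<^sup>2)" if "j \<in> {1..n}" for j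
    by (rule flux_bound[of n "\<lambda>i. radial n (2*i) (2*j-1)"])
      (use n that in \<open>auto intro!: Z ZD\<close>)
  have 2: "(\<Sum>j=1..n. (q i j)\<^sup>2 * (radial n (2*j) (2*i-1) - radial n (2*(j-1)) (2*i-1))) \<le>
      2 * of_int n * (\<Sum>j=1..n-1. (bdist n (2*i-1) (2*j))\<^sup>2 * (q i (j+1) - q i j)\<^sup>2)
      + of_int n / 2 * (\<Sum>j=1..n. (q i j)\<^sup>2)" if "i \<in> {1..n}" for i
    by (rule flux_bound[of n "\<lambda>j. radial n (2*j) (2*i-1)"])
      (use n that in \<open>auto intro!: Z ZD simp: bdist_commute[of n "2*i-1"]\<close>)
  have 0: "(2 * of_int n - 6 * bdist n (2*i-1) (2*j-1)) * (q i j)\<^sup>2 \<le>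
      (q i j)\<^sup>2 * (radial n (2*i) (2*j-1) - radial n (2*(i-1)) (2*j-1))
      + (q i j)\<^sup>2 * (radial n (2*j) (2*i-1) - radial n (2*(j-1)) (2*i-1))" for i j
    unfolding distrib_left[symmetric] mult.commute[of _ "(q i j)\<^sup>2"]
    by (rule mult_left_mono[OF radial_divergence]) simp
  have "(\<Sum>i=1..n. \<Sum>j=1..n. (2 * of_int n - 6 * bdist n (2*i-1) (2*j-1)) * (q i j)\<^sup>2) \<le>
    (\<Sum>i=1..n. \<Sum>j=1..n. (q i j)\<^sup>2 * (radial n (2*i) (2*j-1) - radial n (2*(i-1)) (2*j-1))
       + (q i j)\<^sup>2 * (radial n (2*j) (2*i-1) - radial n (2*(j-1)) (2*i-1)))"
    by (intro sum_mono 0)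
  also have "\<dots> = (\<Sum>i=1..n. \<Sum>j=1..n. (q i j)\<^sup>2 * (radial n (2*i) (2*j-1) - radial n (2*(i-1)) (2*j-1)))
       + (\<Sum>i=1..n. \<Sum>j=1..n. (q i j)\<^sup>2 * (radial n (2*j) (2*i-1) - radial n (2*(j-1)) (2*i-1)))"
    by (simp only: sum.distrib)
  also have "(\<Sum>i=1..n. \<Sum>j=1..n. (q i j)\<^sup>2 * (radial n (2*i) (2*j-1) - radial n (2*(i-1)) (2*j-1)))
      = (\<Sum>j=1..n. \<Sum>i=1..n. (q i j)\<^sup>2 * (radial n (2*i) (2*j-1) - radial n (2*(i-1)) (2*j-1)))"
    by (rule sum.swap)
  also have "\<dots> \<le> (\<Sum>j=1..n. 2 * of_int n * (\<Sum>i=1..n-1. (bdist n (2*i) (2*j-1))\<^sup>2 * (q (i+1) j - q i j)\<^sup>2)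
      + of_int n / 2 * (\<Sum>i=1..n. (q i j)\<^sup>2))"
    by (intro sum_mono 1)
  also have "\<dots> = 2 * of_int n * wgrad1 n q + of_int n / 2 * (\<Sum>j=1..n. \<Sum>i=1..n. (q i j)\<^sup>2)"
    by (simp only: wgrad1_def sum.distrib sum_distrib_left)
  also have "(\<Sum>j=1..n. \<Sum>i=1..n. (q i j)\<^sup>2) = ?Q" by (rule sum.swap)
  also have "(\<Sum>i=1..n. \<Sum>j=1..n. (q i j)\<^sup>2 * (radial n (2*j) (2*i-1) - radial n (2*(j-1)) (2*i-1)))
     \<le> (\<Sum>i=1..n. 2 * of_int n * (\<Sum>j=1..n-1. (bdist n (2*i-1) (2*j))\<^sup>2 * (q i (j+1) - q i j)\<^sup>2)
      + of_int n / 2 * (\<Sum>j=1..n. (q i j)\<^sup>2))"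
    by (intro sum_mono 2)
  also have "\<dots> = 2 * of_int n * wgrad2 n q + of_int n / 2 * ?Q"
    by (simp only: wgrad2_def sum.distrib sum_distrib_left)
  also have "(\<Sum>i=1..n. \<Sum>j=1..n. (2 * of_int n - 6 * bdist n (2*i-1) (2*j-1)) * (q i j)\<^sup>2)
      = 2 * of_int n * ?Q - 6 * (\<Sum>i=1..n. \<Sum>j=1..n. bdist n (2*i-1) (2*j-1) * (q i j)\<^sup>2)"
    by (simp only: left_diff_distrib sum_subtractf sum_distrib_left mult.assoc)
  finally show ?thesis by (simp add: field_simps)
qed


section \<open>Poincare inequality on the core of the square\<close>

lemma sum_pairs_diff_square:
  fixes f :: "'a \<Rightarrow> real"
  assumes "finite A"
  shows "(\<Sum>x\<in>A. \<Sum>y\<in>A. (f x - f y)\<^sup>2) = 2 * real (card A) * (\<Sum>x\<in>A. (f x - sum f A / real (card A))\<^sup>2)"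
proof (cases "A = {}")
  case False
  define c m where "c = real (card A)" and "m = sum f A / c"
  have c: "c > 0" and s: "sum f A = c * m" using False assms by (auto simp: c_def m_def card_gt_0_iff)
  have "(\<Sum>x\<in>A. \<Sum>y\<in>A. (f x - f y)\<^sup>2) = (\<Sum>x\<in>A. \<Sum>y\<in>A. (f x)\<^sup>2 + (f y)\<^sup>2 - 2 * (f x * f y))"
    by (simp add: power2_eq_square algebra_simps)
  also have "\<dots> = c * (\<Sum>x\<in>A. (f x)\<^sup>2) + c * (\<Sum>x\<in>A. (f x)\<^sup>2) - 2 * (sum f A * sum f A)"
    by (simp add: sum.distrib sum_subtractf sum_product c_def flip: sum_distrib_left)
  also have "\<dots> = 2 * c * ((\<Sum>x\<in>A. (f x)\<^sup>2) - 2 * m * sum f A + c * m\<^sup>2)"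
    by (simp add: s power2_eq_square algebra_simps)
  also have "(\<Sum>x\<in>A. (f x)\<^sup>2) - 2 * m * sum f A + c * m\<^sup>2 = (\<Sum>x\<in>A. (f x - m)\<^sup>2)"
  proof -
    have "(f x - m)\<^sup>2 = (f x)\<^sup>2 - 2 * m * f x + m\<^sup>2" for x
      by (simp add: power2_eq_square algebra_simps)
    then show ?thesis by (simp add: sum.distrib sum_subtractf c_def flip: sum_distrib_left)
  qed
  finally show ?thesis by (simp add: c_def m_def)
qed simp

text \<open>A cell has distance more than \<open>n/12\<close> (in half mesh widths) to the boundary iff both of its indices
  lie in \<open>core n\<close>. There the weight is harmless.\<close>

definition core :: "int \<Rightarrow> int set" where
  "core n = {i\<in>{1..n}. 12 * \<bar>2*i-1-n\<bar> < 11 * n}"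

lemma core_edge_bdist:
  assumes "i \<in> core n" "k \<in> core n" "j \<in> core n" "s \<in> {i..k-1}"
  shows "of_int n \<le> 12 * bdist n (2 * s) (2*j-1)"
proof -
  have "12 * \<bar>2 * s-n\<bar> \<le> 11 * n"
    using assms by (auto simp: core_def abs_if split: if_splits)
  moreover have "12 * \<bar>2*j-1-n\<bar> \<le> 11 * n"
    using assms unfolding core_def by simp
  ultimately have "n \<le> 12 * (n - max \<bar>2 * s-n\<bar> \<bar>2*j-1-n\<bar>)" by (simp add: max_def)
  then have "real_of_int n \<le> of_int (12 * (n - max \<bar>2 * s-n\<bar> \<bar>2*j-1-n\<bar>))"
    by (simp only: of_int_le_iff)
  then show ?thesis by (simp add: bdist_def)
qed

text \<open>At most \<open>n\<close> edges join the two cells, and each has weight at least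
  \<open>n/12\<close>; hence \<open>144 = 12^2\<close>.\<close>

lemma core_diff_square_le:
  fixes f :: "int \<Rightarrow> real"
  assumes n: "1 \<le> n" and "i \<in> core n" "k \<in> core n" "j \<in> core n"
  shows "of_int n * (f k - f i)\<^sup>2 \<le> 144 * (\<Sum>s=1..n-1. (bdist n (2 * s) (2*j-1))\<^sup>2 * (f (s+1) - f s)\<^sup>2)"
  using assms(2,3)
proof (induction i k rule: linorder_wlog)
  case (le i k)
  let ?D = "\<lambda>s. bdist n (2 * s) (2*j-1)"
  have ik: "1 \<le> i" "k \<le> n" using le by (auto simp: core_def)
  have D: "(of_int n)\<^sup>2 \<le> 144 * (?D s)\<^sup>2" if "s \<in> {i..k-1}" for s
    using power_mono[OF core_edge_bdist[OF le(2,3) assms(4) that], of 2] n by (simp add: power_mult_distrib)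
  have "(of_int n)\<^sup>2 * (f k - f i)\<^sup>2 \<le> (of_int n)\<^sup>2 * (of_int (k - i) * (\<Sum>s=i..k-1. (f (s+1) - f s)\<^sup>2))"
    by (intro mult_left_mono sum_diff_square_le le) simp
  also have "\<dots> \<le> (of_int n)\<^sup>2 * (of_int n * (\<Sum>s=i..k-1. (f (s+1) - f s)\<^sup>2))"
    using ik by (intro mult_left_mono mult_right_mono sum_nonneg) auto
  also have "\<dots> = of_int n * (\<Sum>s=i..k-1. (of_int n)\<^sup>2 * (f (s+1) - f s)\<^sup>2)"
    by (simp add: sum_distrib_left mult.left_commute)
  also have "\<dots> \<le> of_int n * (\<Sum>s=i..k-1. 144 * (?D s)\<^sup>2 * (f (s+1) - f s)\<^sup>2)"
    using n D by (intro mult_left_mono sum_mono mult_right_mono) auto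
  also have "\<dots> \<le> of_int n * (\<Sum>s=1..n-1. 144 * (?D s)\<^sup>2 * (f (s+1) - f s)\<^sup>2)"
    using n ik by (intro mult_left_mono sum_mono2) auto
  finally have "of_int n * (of_int n * (f k - f i)\<^sup>2) \<le> of_int n * (144 * (\<Sum>s=1..n-1. (?D s)\<^sup>2 * (f (s+1) - f s)\<^sup>2))"
    by (simp add: power2_eq_square sum_distrib_left mult.assoc)
  with n show ?case by simp
next
  case (sym i k)
  then show ?case by (simp add: power2_commute)
qed

text \<open>By \<open>sum_pairs_diff_square\<close> the deviation from the mean is an average over
  pairs of cells. Cells \<open>(i,j)\<close> and \<open>(k,l)\<close> are joined through the corner
  \<open>(k,j)\<close>, so the bound splits into a term for row \<open>j\<close> and one for column
  \<open>k\<close>. In each term three of the four indices are free, whence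
  \<open>c ^ 3\<close>.\<close>

lemma core_poincare:
  fixes q :: gridfun
  assumes n: "1 \<le> n"
  defines "m \<equiv> (\<Sum>(i,j)\<in>core n \<times> core n. q i j) / real (card (core n \<times> core n))"
  shows "(\<Sum>i\<in>core n. \<Sum>j\<in>core n. (q i j - m)\<^sup>2) \<le> 144 * (wgrad1 n q + wgrad2 n q)"
proof (cases "core n = {}")
  case True
  then show ?thesis by (simp add: wgrad1_def wgrad2_def sum_nonneg)
next
  case False
  let ?I = "core n"
  define c where "c = real (card ?I)"
  have fin: "finite ?I" by (rule finite_subset[of _ "{1..n}"]) (auto simp: core_def)
  have "card ?I \<le> card {1..n}" by (rule card_mono) (auto simp: core_def)
  with False fin n have c: "0 < c" "c \<le> of_int n" by (auto simp: c_def card_gt_0_iff)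
  define R where "R j = (\<Sum>s=1..n-1. (bdist n (2 * s) (2*j-1))\<^sup>2 * (q (s+1) j - q s j)\<^sup>2)" for j
  define T where "T i = (\<Sum>s=1..n-1. (bdist n (2*i-1) (2 * s))\<^sup>2 * (q i (s+1) - q i s)\<^sup>2)" for i
  have RT: "sum R ?I \<le> wgrad1 n q" "sum T ?I \<le> wgrad2 n q"
    unfolding wgrad1_def wgrad2_def R_def T_def
    by (intro sum_mono2; auto simp: core_def intro!: sum_nonneg)+
  have pair: "of_int n * (q i j - q k l)\<^sup>2 \<le> 288 * R j + 288 * T k"
    if "i \<in> ?I" "j \<in> ?I" "k \<in> ?I" "l \<in> ?I" for i j k l
  proof -
    have 1: "of_int n * (q i j - q k j)\<^sup>2 \<le> 144 * R j"
      unfolding R_def by (rule core_diff_square_le[of n k i j "\<lambda>s. q s j"]) (use n that in auto)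
    have 2: "of_int n * (q k j - q k l)\<^sup>2 \<le> 144 * T k"
      unfolding T_def bdist_commute[of n "2*k-1"]
      by (rule core_diff_square_le[of n l j k "\<lambda>s. q k s"]) (use n that in auto)
    have "(q i j - q k l)\<^sup>2 \<le> 2 * (q i j - q k j)\<^sup>2 + 2 * (q k j - q k l)\<^sup>2"
      using zero_le_power2[of "(q i j - q k j) - (q k j - q k l)"]
      by (simp add: power2_eq_square algebra_simps)
    then have "of_int n * (q i j - q k l)\<^sup>2 \<le> of_int n * (2 * (q i j - q k j)\<^sup>2 + 2 * (q k j - q k l)\<^sup>2)"
      using n by (intro mult_left_mono) auto
    with 1 2 show ?thesis by (simp add: algebra_simps)
  qed
  let ?S = "\<Sum>i\<in>?I. \<Sum>j\<in>?I. (q i j - m)\<^sup>2"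
  have "of_int n * (2 * c\<^sup>2 * ?S) = (\<Sum>(i,j)\<in>?I\<times>?I. \<Sum>(k,l)\<in>?I\<times>?I. of_int n * (q i j - q k l)\<^sup>2)"
    using sum_pairs_diff_square[of "?I \<times> ?I" "\<lambda>(i,j). q i j"] fin
    by (simp add: case_prod_unfold m_def c_def sum.cartesian_product card_cartesian_product power2_eq_square
        flip: sum_distrib_left)
  also have "\<dots> \<le> (\<Sum>(i,j)\<in>?I\<times>?I. \<Sum>(k,l)\<in>?I\<times>?I. 288 * R j + 288 * T k)"
    by (intro sum_mono) (auto intro!: sum_mono pair)
  also have "\<dots> = 288 * c ^ 3 * (sum R ?I + sum T ?I)"
    by (simp add: sum.cartesian_product[symmetric] sum.distrib flip: sum_distrib_left c_def)
      (simp add: power3_eq_cube algebra_simps)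
  also have "\<dots> \<le> 288 * (c\<^sup>2 * of_int n) * (wgrad1 n q + wgrad2 n q)"
    using RT c by (intro mult_mono add_mono) (auto simp: R_def T_def power2_eq_square power3_eq_cube
        intro!: mult_left_mono add_nonneg_nonneg sum_nonneg)
  finally have "(of_int n * (2 * c\<^sup>2)) * ?S \<le> (of_int n * (2 * c\<^sup>2)) * (144 * (wgrad1 n q + wgrad2 n q))"
    by (simp add: algebra_simps)
  then show ?thesis using n c by (subst (asm) mult_le_cancel_left_pos) auto
qed

text \<open>The estimate is made for \<open>r = q - m\<close> with the core mean \<open>m\<close>,
  which has the same differences as \<open>q\<close>. Returning to \<open>q\<close> costs nothing: a
  mean-free function has the least norm among its shifts by constants. The constant is
  \<open>1732 = 2 * (6 * 144 + 2)\<close>.\<close>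

lemma weighted_poincare:
  assumes n: "1 \<le> n" and mean: "(\<Sum>i=1..n. \<Sum>j=1..n. q i j) = 0"
  shows "(\<Sum>i=1..n. \<Sum>j=1..n. (q i j)\<^sup>2) \<le> 1732 * (wgrad1 n q + wgrad2 n q)"
proof -
  define m where "m = (\<Sum>(i,j)\<in>core n \<times> core n. q i j) / real (card (core n \<times> core n))"
  define r where "r i j = q i j - m" for i j
  define E where "E = wgrad1 n q + wgrad2 n q"
  let ?S = "\<lambda>f. \<Sum>i=1..n. \<Sum>j=1..n. (f i j :: real)"
  have wr: "wgrad1 n r + wgrad2 n r = E" by (simp add: E_def wgrad1_def wgrad2_def r_def)
  have inr: "(\<Sum>i\<in>core n. \<Sum>j\<in>core n. (r i j)\<^sup>2) \<le> 144 * E"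
    using core_poincare[OF n, of q] by (simp add: r_def m_def E_def)
  \<comment> \<open>The threshold \<open>n/12\<close> in \<open>core\<close> yields the coefficient
    \<open>n/2\<close> outside the core, half of what \<open>hardy_square\<close> has on its
    left.\<close>
  have pt: "6 * (bdist n (2*i-1) (2*j-1) * (r i j)\<^sup>2) \<le>
      of_int n / 2 * (r i j)\<^sup>2 + (if i \<in> core n \<and> j \<in> core n then 6 * of_int n * (r i j)\<^sup>2 else 0)"
    if "i \<in> {1..n}" "j \<in> {1..n}" for i j
  proof (cases "i \<in> core n \<and> j \<in> core n")
    case True
    have "6 * bdist n (2*i-1) (2*j-1) \<le> of_int n / 2 + 6 * of_int n"
      using n bdist_le[of n "2*i-1" "2*j-1"] by simp
    from mult_right_mono[OF this, of "(r i j)\<^sup>2"] True show ?thesis by (simp add: algebra_simps)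
  next
    case False
    have "12 * (n - max A B) \<le> n" if "\<not> (12 * A < 11 * n \<and> 12 * B < 11 * n)" for A B
      using that by (auto simp: max_def)
    moreover have "\<not> (12 * \<bar>2*i-1-n\<bar> < 11 * n \<and> 12 * \<bar>2*j-1-n\<bar> < 11 * n)"
      using False that by (auto simp: core_def)
    ultimately have "12 * (n - max \<bar>2*i-1-n\<bar> \<bar>2*j-1-n\<bar>) \<le> n" by blast
    then have "real_of_int (12 * (n - max \<bar>2*i-1-n\<bar> \<bar>2*j-1-n\<bar>)) \<le> of_int n"
      by (simp only: of_int_le_iff)
    then have "6 * bdist n (2*i-1) (2*j-1) \<le> of_int n / 2"
      by (simp add: bdist_def)
    from mult_right_mono[OF this, of "(r i j)\<^sup>2"] False show ?thesis by (auto simp: algebra_simps)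
  qed
  have "(\<Sum>i=1..n. \<Sum>j=1..n. if i \<in> core n \<and> j \<in> core n then 6 * of_int n * (r i j)\<^sup>2 else 0)
      = 6 * of_int n * (\<Sum>i\<in>core n. \<Sum>j\<in>core n. (r i j)\<^sup>2)"
  proof -
    have I: "core n = {i \<in> {1..n}. i \<in> core n}" by (auto simp: core_def)
    have "(\<Sum>i\<in>core n. \<Sum>j\<in>core n. 6 * of_int n * (r i j)\<^sup>2) =
      (\<Sum>i=1..n. if i \<in> core n then \<Sum>j=1..n. if j \<in> core n then 6 * of_int n * (r i j)\<^sup>2 else 0 else 0)"
      by (subst (1 2) I) (simp only: sum.inter_filter[symmetric] finite_atLeastAtMost_int)
    also have "\<dots> = (\<Sum>i=1..n. \<Sum>j=1..n. if i \<in> core n \<and> j \<in> core n then 6 * of_int n * (r i j)\<^sup>2 else 0)"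
      by (intro sum.cong) auto
    finally show ?thesis by (simp add: sum_distrib_left)
  qed
  moreover have "6 * ?S (\<lambda>i j. bdist n (2*i-1) (2*j-1) * (r i j)\<^sup>2) \<le>
     ?S (\<lambda>i j. of_int n / 2 * (r i j)\<^sup>2 + (if i \<in> core n \<and> j \<in> core n then 6 * of_int n * (r i j)\<^sup>2 else 0))"
    unfolding sum_distrib_left by (intro sum_mono pt)
  ultimately have "6 * ?S (\<lambda>i j. bdist n (2*i-1) (2*j-1) * (r i j)\<^sup>2) \<le>
     of_int n / 2 * ?S (\<lambda>i j. (r i j)\<^sup>2) + 6 * of_int n * (\<Sum>i\<in>core n. \<Sum>j\<in>core n. (r i j)\<^sup>2)"
    by (simp only: sum.distrib sum_distrib_left)
  with hardy_square[OF n, of r] have "of_int n * ?S (\<lambda>i j. (r i j)\<^sup>2) \<le>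
     of_int n * (?S (\<lambda>i j. (r i j)\<^sup>2) / 2 + 6 * (\<Sum>i\<in>core n. \<Sum>j\<in>core n. (r i j)\<^sup>2) + 2 * E)"
    unfolding wr by (simp add: algebra_simps)
  then have "?S (\<lambda>i j. (r i j)\<^sup>2) \<le>
     ?S (\<lambda>i j. (r i j)\<^sup>2) / 2 + 6 * (\<Sum>i\<in>core n. \<Sum>j\<in>core n. (r i j)\<^sup>2) + 2 * E"
    using n by (subst (asm) mult_le_cancel_left_pos) auto
  with inr have "?S (\<lambda>i j. (r i j)\<^sup>2) \<le> 1732 * E" by simp
  moreover have "?S (\<lambda>i j. (r i j)\<^sup>2) = ?S (\<lambda>i j. (q i j)\<^sup>2) - 2 * m * ?S q + (of_int n)\<^sup>2 * m\<^sup>2"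
  proof -
    have "(r i j)\<^sup>2 = (q i j)\<^sup>2 - 2 * m * q i j + m\<^sup>2" for i j
      by (simp add: r_def power2_eq_square algebra_simps)
    then show ?thesis using n
      by (simp add: sum.distrib sum_subtractf power2_eq_square flip: sum_distrib_left)
  qed
  ultimately show ?thesis using mean by (simp add: E_def) (smt (verit) mult_nonneg_nonneg zero_le_power2)
qed

subsection \<open>A Caccioppoli inequality for the discrete Cauchy-Riemann equations\<close>

text \<open>Both sides equal minus the sum of \<open>p\<close> against the mixed second difference
  of \<open>\<psi>\<close>.\<close>

lemma curl_grad_orthogonal:
  fixes p \<psi> :: gridfun
  assumes n: "1 \<le> n"
    and bc: "\<And>i. \<psi> i 0 = 0" "\<And>i. \<psi> i n = 0" "\<And>j. \<psi> 0 j = 0" "\<And>j. \<psi> n j = 0"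
  shows "(\<Sum>j=1..n. \<Sum>i=1..n-1. (p (i+1) j - p i j) * (\<psi> i j - \<psi> i (j-1)))
       = (\<Sum>i=1..n. \<Sum>j=1..n-1. (p i (j+1) - p i j) * (\<psi> i j - \<psi> (i-1) j))"
proof -
  have 1: "(\<Sum>i=1..n-1. (p (i+1) j - p i j) * (\<psi> i j - \<psi> i (j-1)))
      = - (\<Sum>i=1..n. p i j * ((\<psi> i j - \<psi> i (j-1)) - (\<psi> (i-1) j - \<psi> (i-1) (j-1))))" for j
    using sum_by_parts_0[OF n, of "\<lambda>i. \<psi> i j - \<psi> i (j-1)" "\<lambda>i. p i j"] bc by simp
  have 2: "(\<Sum>j=1..n-1. (p i (j+1) - p i j) * (\<psi> i j - \<psi> (i-1) j))
      = - (\<Sum>j=1..n. p i j * ((\<psi> i j - \<psi> (i-1) j) - (\<psi> i (j-1) - \<psi> (i-1) (j-1))))" for i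
    using sum_by_parts_0[OF n, of "\<lambda>j. \<psi> i j - \<psi> (i-1) j" "\<lambda>j. p i j"] bc by simp
  show ?thesis
    unfolding 1 2 sum_negf
    by (subst sum.swap) (simp add: algebra_simps)
qed

text \<open>The last term is \<open>grad P\<close> times the difference of the test function \<open>W\<^sup>2 \<omega>\<close> along the edge, so it
  drops out after summation by \<open>curl_grad_orthogonal\<close>.\<close>

lemma caccioppoli_edge:
  fixes d f n x y w w' :: real
  assumes w: "\<bar>w - w'\<bar> \<le> 2" "2 \<le> w + w'" "0 \<le> w" "0 \<le> w'" "w \<le> n" "w' \<le> n"
    and d: "0 \<le> d" "d \<le> n" "d \<le> w + 1" "d \<le> w' + 1"
  shows "d\<^sup>2 * (f - (x - y))\<^sup>2 \<le>
    34 * (n\<^sup>2 * f\<^sup>2) + 160 * (x\<^sup>2 + y\<^sup>2) - 16 * ((f - (x - y)) * (w\<^sup>2 * x - w'\<^sup>2 * y))"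
proof -
  \<comment> \<open>Mean and half-difference of the weights, mean and difference of the vorticities.
    In these variables \<open>flux\<close> is a discrete product rule with principal part
    \<open>(s^2 + t^2) * a\<close> and commutator \<open>4 * s * t * m\<close>, where
    \<open>\<bar>t\<bar> \<le> 1\<close>.\<close>
  define s t m a where "s = (w + w') / 2" and "t = (w - w') / 2" and "m = (x + y) / 2" and "a = x - y"
  have s: "1 \<le> s" "s \<le> n" and t: "\<bar>t\<bar> \<le> 1" using w by (auto simp: s_def t_def)
  have t2: "t\<^sup>2 \<le> 1" using t by (simp add: abs_square_le_1)
  have s2: "s\<^sup>2 \<le> n\<^sup>2" using s by (intro power_mono) auto
  have \<phi>n: "s\<^sup>2 + t\<^sup>2 \<le> n\<^sup>2"
  proof -
    have "w\<^sup>2 \<le> n\<^sup>2" "w'\<^sup>2 \<le> n\<^sup>2" using w by (auto intro!: power_mono)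
    then show ?thesis by (simp add: s_def t_def power2_eq_square field_simps)
  qed
  have flux: "w\<^sup>2 * x - w'\<^sup>2 * y = (s\<^sup>2 + t\<^sup>2) * a + 4 * s * t * m"
    by (simp add: s_def t_def a_def m_def power2_eq_square field_simps)
  have d1: "d\<^sup>2 \<le> n\<^sup>2" using d by (intro power_mono) auto
  \<comment> \<open>Averaging the bounds by the two ends gives \<open>d \<le> s + 1\<close>, and
    \<open>1 \<le> s\<close>.\<close>
  have "d \<le> 2 * s" using d s by (simp add: s_def)
  then have "d\<^sup>2 \<le> (2 * s)\<^sup>2" using d by (intro power_mono) auto
  then have d2: "d\<^sup>2 \<le> 4 * (s\<^sup>2 + t\<^sup>2)"
    by (simp add: power_mult_distrib add_increasing2)
  have "(f - a)\<^sup>2 \<le> 2 * f\<^sup>2 + 2 * a\<^sup>2"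
    using zero_le_power2[of "f + a"] by (simp add: power2_eq_square algebra_simps)
  then have "d\<^sup>2 * (f - a)\<^sup>2 \<le> d\<^sup>2 * (2 * f\<^sup>2 + 2 * a\<^sup>2)" by (rule mult_left_mono) simp
  then have e1: "d\<^sup>2 * (f - a)\<^sup>2 \<le> 2 * (n\<^sup>2 * f\<^sup>2) + 8 * ((s\<^sup>2 + t\<^sup>2) * a\<^sup>2)"
    using mult_right_mono[OF d1, of "f\<^sup>2"] mult_right_mono[OF d2, of "a\<^sup>2"]
    by (simp add: algebra_simps)
  have "f * a \<le> a\<^sup>2 / 4 + f\<^sup>2"
    using zero_le_power2[of "f - a/2"] by (simp add: power2_eq_square field_simps)
  then have "(s\<^sup>2 + t\<^sup>2) * (f * a) \<le> (s\<^sup>2 + t\<^sup>2) * (a\<^sup>2 / 4 + f\<^sup>2)" by (rule mult_left_mono) simp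
  then have e2: "(s\<^sup>2 + t\<^sup>2) * (f * a) \<le> (s\<^sup>2 + t\<^sup>2) * a\<^sup>2 / 4 + n\<^sup>2 * f\<^sup>2"
    using mult_right_mono[OF \<phi>n, of "f\<^sup>2"] by (simp add: field_simps)
  have tm: "t\<^sup>2 * m\<^sup>2 \<le> m\<^sup>2" using mult_right_mono[OF t2, of "m\<^sup>2"] by simp
  have "4 * s * t * m * f \<le> s\<^sup>2 * f\<^sup>2 + 4 * (t\<^sup>2 * m\<^sup>2)"
    using zero_le_power2[of "s * f - 2 * t * m"] by (simp add: power2_eq_square algebra_simps)
  then have e3: "4 * s * t * m * f \<le> n\<^sup>2 * f\<^sup>2 + 4 * m\<^sup>2"
    using tm mult_right_mono[OF s2, of "f\<^sup>2"] by simp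
  have "- (4 * s * t * m * a) \<le> s\<^sup>2 * a\<^sup>2 / 4 + 16 * (t\<^sup>2 * m\<^sup>2)"
    using zero_le_power2[of "s * a / 2 + 4 * t * m"] by (simp add: power2_eq_square field_simps)
  then have e4: "- (4 * s * t * m * a) \<le> (s\<^sup>2 + t\<^sup>2) * a\<^sup>2 / 4 + 16 * m\<^sup>2"
    using tm mult_right_mono[of "s\<^sup>2" "s\<^sup>2 + t\<^sup>2" "a\<^sup>2"] by simp
  have m2: "m\<^sup>2 \<le> (x\<^sup>2 + y\<^sup>2) / 2"
    using zero_le_power2[of "x - y"] by (simp add: m_def power2_eq_square field_simps)
  have "(f - a) * ((s\<^sup>2 + t\<^sup>2) * a + 4 * s * t * m) =
     (s\<^sup>2 + t\<^sup>2) * (f * a) + 4 * s * t * m * f - 4 * s * t * m * a - (s\<^sup>2 + t\<^sup>2) * a\<^sup>2"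
    by (simp add: power2_eq_square algebra_simps)
  with e2 e3 e4 have "(f - a) * ((s\<^sup>2 + t\<^sup>2) * a + 4 * s * t * m) \<le>
     2 * (n\<^sup>2 * f\<^sup>2) + 20 * m\<^sup>2 - (s\<^sup>2 + t\<^sup>2) * a\<^sup>2 / 2" by linarith
  \<comment> \<open>The factor 16 turns the surplus \<open>(s^2 + t^2) * a^2 / 2\<close> into the 8
    needed by \<open>e1\<close>. The other constants follow: \<open>34 = 2 + 16 * 2\<close> and
    \<open>160 = 16 * 20 / 2\<close>.\<close>
  with e1 m2 show ?thesis unfolding flux a_def[symmetric] by linarith
qed

lemma bdist_nonneg: "0 \<le> a \<Longrightarrow> a \<le> 2*n \<Longrightarrow> 0 \<le> b \<Longrightarrow> b \<le> 2*n \<Longrightarrow> 0 \<le> bdist n a b"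
proof -
  assume "0 \<le> a" "a \<le> 2*n" "0 \<le> b" "b \<le> 2*n"
  then have "\<bar>a-n\<bar> \<le> n" "\<bar>b-n\<bar> \<le> n" by linarith+
  then show ?thesis by (simp add: bdist_def)
qed

lemma bdist_boundary: "0 \<le> b \<Longrightarrow> b \<le> 2*n \<Longrightarrow> bdist n 0 b = 0 \<and> bdist n (2*n) b = 0"
  by (auto simp: bdist_def)

lemma bdist_step: "\<bar>bdist n a (b-1) - bdist n a b\<bar> \<le> 1"
proof -
  have "\<bar>(n - max A B) - (n - max A C)\<bar> \<le> 1" if "\<bar>B - C\<bar> \<le> 1" for A B C :: int
    using that by (auto simp: max_def)
  moreover have "\<bar>\<bar>b-1-n\<bar> - \<bar>b-n\<bar>\<bar> \<le> 1" by linarith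
  ultimately have "\<bar>(n - max \<bar>a-n\<bar> \<bar>b-1-n\<bar>) - (n - max \<bar>a-n\<bar> \<bar>b-n\<bar>)\<bar> \<le> 1"
    by blast
  then have "real_of_int \<bar>(n - max \<bar>a-n\<bar> \<bar>b-1-n\<bar>) - (n - max \<bar>a-n\<bar> \<bar>b-n\<bar>)\<bar> \<le> 1"
    by (simp only: of_int_le_1_iff)
  then show ?thesis by (simp only: bdist_def of_int_abs of_int_diff)
qed

lemma bdist_interior_vertex:
  assumes "1 \<le> i" "i \<le> n-1" "1 \<le> j" "j \<le> n-1"
  shows "2 \<le> bdist n (2*i) (2*j)"
proof -
  have "\<bar>2*i-n\<bar> \<le> n-2" "\<bar>2*j-n\<bar> \<le> n-2" using assms by auto
  then have "2 \<le> n - max \<bar>2*i-n\<bar> \<bar>2*j-n\<bar>" by (simp add: max_def)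
  then have "real_of_int 2 \<le> of_int (n - max \<bar>2*i-n\<bar> \<bar>2*j-n\<bar>)" by (simp only: of_int_le_iff)
  then show ?thesis by (simp add: bdist_def)
qed

lemma caccioppoli_bdist_edge:
  fixes f x y :: real
  assumes ij: "i \<in> {1..n-1}" "j \<in> {1..n}"
  shows "(bdist n (2*i) (2*j-1))\<^sup>2 * (f - (x - y))\<^sup>2 \<le>
    34 * ((of_int n)\<^sup>2 * f\<^sup>2) + 160 * (x\<^sup>2 + y\<^sup>2)
    - 16 * ((f - (x - y)) * ((bdist n (2*i) (2*j))\<^sup>2 * x - (bdist n (2*i) (2*(j-1)))\<^sup>2 * y))"
proof -
  let ?w = "bdist n (2*i) (2*j)" and ?w' = "bdist n (2*i) (2*(j-1))" and ?d = "bdist n (2*i) (2*j-1)"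
  have step: "\<bar>?d - ?w\<bar> \<le> 1" "\<bar>?w' - ?d\<bar> \<le> 1"
    using bdist_step[of n "2*i" "2*j"] bdist_step[of n "2*i" "2*j-1"] by (simp_all add: algebra_simps)
  have nonneg: "0 \<le> ?w" "0 \<le> ?w'" "0 \<le> ?d"
    using ij by (auto intro!: bdist_nonneg)
  \<comment> \<open>At least one end of the edge is an interior vertex, even when the other lies on
    the boundary.\<close>
  have "2 \<le> ?w \<or> 2 \<le> ?w'"
  proof (cases "j = n")
    case True
    then show ?thesis using ij bdist_interior_vertex[of i n "j-1"] by auto
  next
    case False
    then show ?thesis using ij bdist_interior_vertex[of i n j] by auto
  qed
  with nonneg have "2 \<le> ?w + ?w'" by auto
  with step nonneg show ?thesis by (intro caccioppoli_edge bdist_le) auto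
qed

lemma caccioppoli:
  fixes P \<omega> f1 f2 :: gridfun
  assumes n: "1 \<le> n"
    and eq1: "\<And>i j. i \<in> {1..n-1} \<Longrightarrow> j \<in> {1..n} \<Longrightarrow> P (i+1) j - P i j = f1 i j - (\<omega> i j - \<omega> i (j-1))"
    and eq2: "\<And>i j. i \<in> {1..n} \<Longrightarrow> j \<in> {1..n-1} \<Longrightarrow> P i (j+1) - P i j = f2 i j + (\<omega> i j - \<omega> (i-1) j)"
  shows "wgrad1 n P + wgrad2 n P \<le>
    34 * ((of_int n)\<^sup>2 * ((\<Sum>j=1..n. \<Sum>i=1..n-1. (f1 i j)\<^sup>2) + (\<Sum>i=1..n. \<Sum>j=1..n-1. (f2 i j)\<^sup>2)))
    + 160 * ((\<Sum>j=1..n. \<Sum>i=1..n-1. (\<omega> i j)\<^sup>2 + (\<omega> i (j-1))\<^sup>2) +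
             (\<Sum>i=1..n. \<Sum>j=1..n-1. (\<omega> i j)\<^sup>2 + (\<omega> (i-1) j)\<^sup>2))"
proof -
  \<comment> \<open>Outside the grid \<open>bdist\<close> is negative, while
    \<open>curl_grad_orthogonal\<close> asks for zero values along whole lines; hence the
    truncation.\<close>
  define W \<psi> where "W i j = (if i \<in> {0..n} \<and> j \<in> {0..n} then bdist n (2*i) (2*j) else 0)"
    and "\<psi> i j = (W i j)\<^sup>2 * \<omega> i j" for i j
  have bd: "\<psi> i 0 = 0" "\<psi> i n = 0" "\<psi> 0 j = 0" "\<psi> n j = 0" for i j
    using bdist_boundary[of "2*j" n] bdist_boundary[of "2*i" n] n bdist_commute[of n "2*i"]
    by (auto simp: \<psi>_def W_def)
  have 1: "(bdist n (2*i) (2*j-1))\<^sup>2 * (P (i+1) j - P i j)\<^sup>2 \<le>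
      34 * (of_int n)\<^sup>2 * (f1 i j)\<^sup>2 + 160 * ((\<omega> i j)\<^sup>2 + (\<omega> i (j-1))\<^sup>2)
      - 16 * ((P (i+1) j - P i j) * (\<psi> i j - \<psi> i (j-1)))" if "i \<in> {1..n-1}" "j \<in> {1..n}" for i j
    using caccioppoli_bdist_edge[OF that, of "f1 i j" "\<omega> i j" "\<omega> i (j-1)"] that
    by (simp add: eq1 \<psi>_def W_def)
  have 2: "(bdist n (2*i-1) (2*j))\<^sup>2 * (P i (j+1) - P i j)\<^sup>2 \<le>
      34 * (of_int n)\<^sup>2 * (f2 i j)\<^sup>2 + 160 * ((\<omega> i j)\<^sup>2 + (\<omega> (i-1) j)\<^sup>2)
      + 16 * ((P i (j+1) - P i j) * (\<psi> i j - \<psi> (i-1) j))" if "i \<in> {1..n}" "j \<in> {1..n-1}" for i j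
  proof -
    \<comment> \<open>Swapping the coordinates reverses the sign of the curl, so the edge estimate
      is applied to \<open>- f2\<close>. The flux term thereby gets the sign opposite to the one in
      the first direction, and the two sums cancel.\<close>
    have "(- f2 i j - (\<omega> i j - \<omega> (i-1) j)) = - (P i (j+1) - P i j)" using eq2[OF that] by simp
    with caccioppoli_bdist_edge[OF that(2,1), of "- f2 i j" "\<omega> i j" "\<omega> (i-1) j"]
    have "(bdist n (2*j) (2*i-1))\<^sup>2 * (P i (j+1) - P i j)\<^sup>2 \<le>
      34 * ((of_int n)\<^sup>2 * (f2 i j)\<^sup>2) + 160 * ((\<omega> i j)\<^sup>2 + (\<omega> (i-1) j)\<^sup>2)
      - 16 * (- (P i (j+1) - P i j) * ((bdist n (2*j) (2*i))\<^sup>2 * \<omega> i j - (bdist n (2*j) (2*(i-1)))\<^sup>2 * \<omega> (i-1) j))"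
      by (simp only: power2_minus)
    moreover have "W i j = bdist n (2*j) (2*i)" "W (i-1) j = bdist n (2*j) (2*(i-1))"
      using that by (auto simp: W_def bdist_commute[of n "2*j"])
    ultimately show ?thesis unfolding bdist_commute[of n "2*i-1"] \<psi>_def
      by (simp only: mult_minus_left mult_minus_right diff_minus_eq_add mult.assoc)
  qed
  have "wgrad1 n P + wgrad2 n P \<le>
     (\<Sum>j=1..n. \<Sum>i=1..n-1. 34 * (of_int n)\<^sup>2 * (f1 i j)\<^sup>2 + 160 * ((\<omega> i j)\<^sup>2 + (\<omega> i (j-1))\<^sup>2)
      - 16 * ((P (i+1) j - P i j) * (\<psi> i j - \<psi> i (j-1)))) +
     (\<Sum>i=1..n. \<Sum>j=1..n-1. 34 * (of_int n)\<^sup>2 * (f2 i j)\<^sup>2 + 160 * ((\<omega> i j)\<^sup>2 + (\<omega> (i-1) j)\<^sup>2)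
      + 16 * ((P i (j+1) - P i j) * (\<psi> i j - \<psi> (i-1) j)))"
    unfolding wgrad1_def wgrad2_def by (intro add_mono sum_mono 1 2)
  also have "\<dots> = (34 * (of_int n)\<^sup>2 * (\<Sum>j=1..n. \<Sum>i=1..n-1. (f1 i j)\<^sup>2)
      + 160 * (\<Sum>j=1..n. \<Sum>i=1..n-1. (\<omega> i j)\<^sup>2 + (\<omega> i (j-1))\<^sup>2)
      - 16 * (\<Sum>j=1..n. \<Sum>i=1..n-1. (P (i+1) j - P i j) * (\<psi> i j - \<psi> i (j-1)))) +
     (34 * (of_int n)\<^sup>2 * (\<Sum>i=1..n. \<Sum>j=1..n-1. (f2 i j)\<^sup>2)
      + 160 * (\<Sum>i=1..n. \<Sum>j=1..n-1. (\<omega> i j)\<^sup>2 + (\<omega> (i-1) j)\<^sup>2)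
      + 16 * (\<Sum>i=1..n. \<Sum>j=1..n-1. (P i (j+1) - P i j) * (\<psi> i j - \<psi> (i-1) j)))"
    by (simp only: sum.distrib sum_subtractf sum_distrib_left distrib_left)
  finally show ?thesis
    using curl_grad_orthogonal[OF n bd, of P] by (simp add: algebra_simps)
qed

subsection \<open>Stability of the MAC scheme\<close>

lemma sum_rho:
  assumes N: "0 < N"
  shows "(\<Sum>j=0..int N. rho N j * g j) = (\<Sum>j=1..int N. g j + g (j-1)) / 2"
    and "(\<Sum>j=0..int N. rho N j * g j) = g 0 / 2 + (\<Sum>j=1..int N - 1. g j) + g (int N) / 2"
proof -
  have split: "{0..int N} = insert 0 (insert (int N) {1..int N - 1})"
    "{1..int N} = insert (int N) {1..int N - 1}" "{0..int N - 1} = insert 0 {1..int N - 1}"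
    using N by auto
  have "(\<Sum>j=1..int N - 1. rho N j * g j) = (\<Sum>j=1..int N - 1. g j)"
    by (intro sum.cong) (auto simp: rho_def)
  then show *: "(\<Sum>j=0..int N. rho N j * g j) = g 0 / 2 + (\<Sum>j=1..int N - 1. g j) + g (int N) / 2"
    unfolding split(1) using N by (simp add: rho_def)
  have "(\<Sum>j=1..int N. g j + g (j-1)) = (\<Sum>j=1..int N. g j) + (\<Sum>j=0..int N - 1. g j)"
    using sum_pred_shift[of g "int N"] by (simp add: sum.distrib)
  then show "(\<Sum>j=0..int N. rho N j * g j) = (\<Sum>j=1..int N. g j + g (j-1)) / 2"
    unfolding * split(2,3) by simp
qed

section \<open>One-dimensional energy identities and Poincare inequality\<close>

lemma energy_dirichlet:
  fixes v :: "int \<Rightarrow> real"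
  assumes n: "1 \<le> n" and "v 0 = 0" "v n = 0"
  shows "(\<Sum>i=1..n-1. (2 * v i - v (i-1) - v (i+1)) * v i) = (\<Sum>i=1..n. (v i - v (i-1))\<^sup>2)"
proof -
  have "(\<Sum>i=1..n. (v i - v (i-1)) * (v i - v (i-1)))
      = (\<Sum>i=1..n-1. - ((v (i+1) - v (i+1-1) - (v i - v (i-1))) * v i))"
    unfolding sum_negf by (rule sum_by_parts_0) (use assms in auto)
  then show ?thesis by (simp add: power2_eq_square algebra_simps)
qed

text \<open>Reflection makes the difference at an end equal to \<open>2 * v 1\<close> up to sign, so
  the boundary term \<open>2 * (v 1)^2\<close> is half of its square: this is the weight
  \<open>rho = 1/2\<close>.\<close>

lemma energy_reflect:
  fixes v :: "int \<Rightarrow> real"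
  assumes N: "0 < N" and "v 0 = - v 1" "v (int N + 1) = - v (int N)"
  shows "(\<Sum>i=1..int N. (2 * v i - v (i-1) - v (i+1)) * v i)
       = (\<Sum>i=0..int N. rho N i * (v (i+1) - v i)\<^sup>2)"
proof -
  have "(\<Sum>i=1..int N. (2 * v i - v (i-1) - v (i+1)) * v i)
      = - (\<Sum>i=1..int N. v i * ((v (i+1) - v i) - (v (i-1+1) - v (i-1))))"
    unfolding sum_negf[symmetric] by (intro sum.cong) (auto simp: algebra_simps)
  also have "\<dots> = (\<Sum>i=1..int N - 1. (v (i+1) - v i)\<^sup>2) + v 1 * (v 1 - v 0) - v (int N) * (v (int N + 1) - v (int N))"
    using sum_by_parts[of "int N" v "\<lambda>i. v (i+1) - v i"] N by (simp add: power2_eq_square)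
  finally show ?thesis
    unfolding sum_rho(2)[OF N] using assms(2,3) by (simp add: power2_eq_square)
qed

lemma poincare_dirichlet:
  fixes v :: "int \<Rightarrow> real"
  assumes n: "1 \<le> n" and v0: "v 0 = 0"
  shows "(\<Sum>i=1..n-1. (v i)\<^sup>2) \<le> (of_int n)\<^sup>2 * (\<Sum>i=1..n. (v i - v (i-1))\<^sup>2)"
proof -
  let ?S = "\<Sum>i=1..n. (v i - v (i-1))\<^sup>2"
  have S: "?S = (\<Sum>i=0..n-1. (v (i+1) - v i)\<^sup>2)"
    using sum_pred_shift[of "\<lambda>i. (v (i+1) - v i)\<^sup>2" n] by simp
  have "(v i)\<^sup>2 \<le> of_int n * ?S" if i: "i \<in> {1..n-1}" for i
  proof -
    have "(v i - v 0)\<^sup>2 \<le> of_int (i - 0) * (\<Sum>s=0..i-1. (v (s+1) - v s)\<^sup>2)"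
      using i by (intro sum_diff_square_le) auto
    also have "\<dots> \<le> of_int n * ?S"
      unfolding S using i n by (intro mult_mono sum_mono2 sum_nonneg) auto
    finally show ?thesis by (simp add: v0)
  qed
  then have "(\<Sum>i=1..n-1. (v i)\<^sup>2) \<le> (\<Sum>i=1..n-1. of_int n * ?S)" by (rule sum_mono)
  also have "\<dots> = of_int (n-1) * (of_int n * ?S)" using n by simp
  also have "\<dots> \<le> of_int n * (of_int n * ?S)"
    using n by (intro mult_right_mono mult_nonneg_nonneg sum_nonneg) auto
  finally show ?thesis by (simp add: power2_eq_square)
qed

section \<open>Energy, divergence and vorticity with undivided differences\<close>

text \<open>From here to \<open>unscaled_stability\<close> all difference operators are undivided, so that no powers of
  \<open>h\<close> occur: \<open>Q\<close> stands for \<open>h p\<close>, \<open>f\<close> for \<open>h\<^sup>2\<close> times the force.\<close>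

definition energy :: "nat \<Rightarrow> gridfun \<Rightarrow> gridfun \<Rightarrow> real" where
  "energy N v1 v2 =
     (\<Sum>i=1..int N. \<Sum>j=1..int N. (v1 i j - v1 (i-1) j)\<^sup>2) +
     (\<Sum>i=1..int N - 1. \<Sum>j=0..int N. rho N j * (v1 i (j+1) - v1 i j)\<^sup>2) +
     (\<Sum>i=0..int N. \<Sum>j=1..int N - 1. rho N i * (v2 (i+1) j - v2 i j)\<^sup>2) +
     (\<Sum>i=1..int N. \<Sum>j=1..int N. (v2 i j - v2 i (j-1))\<^sup>2)"

definition neg_lap :: "gridfun \<Rightarrow> gridfun" where
  "neg_lap v i j = (2 * v i j - v (i-1) j - v (i+1) j) + (2 * v i j - v i (j-1) - v i (j+1))"

definition divg :: "gridfun \<Rightarrow> gridfun \<Rightarrow> gridfun" where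
  "divg v1 v2 i j = (v1 i j - v1 (i-1) j) + (v2 i j - v2 i (j-1))"

definition vort :: "gridfun \<Rightarrow> gridfun \<Rightarrow> gridfun" where
  "vort v1 v2 i j = (v2 (i+1) j - v2 i j) - (v1 i (j+1) - v1 i j)"

lemma energy_eq:
  assumes N: "0 < N" and V: "v1 \<in> V1 N" "v2 \<in> V2 N"
  shows "energy N v1 v2 = (\<Sum>i=1..int N - 1. \<Sum>j=1..int N. neg_lap v1 i j * v1 i j) +
    (\<Sum>i=1..int N. \<Sum>j=1..int N - 1. neg_lap v2 i j * v2 i j)"
proof -
  let ?n = "int N"
  have a: "(\<Sum>j=1..?n. \<Sum>i=1..?n-1. (2 * v1 i j - v1 (i-1) j - v1 (i+1) j) * v1 i j)
      = (\<Sum>j=1..?n. \<Sum>i=1..?n. (v1 i j - v1 (i-1) j)\<^sup>2)"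
    using N V by (intro sum.cong refl energy_dirichlet) (auto simp: V1_def)
  have b: "(\<Sum>i=1..?n-1. \<Sum>j=1..?n. (2 * v1 i j - v1 i (j-1) - v1 i (j+1)) * v1 i j)
      = (\<Sum>i=1..?n-1. \<Sum>j=0..?n. rho N j * (v1 i (j+1) - v1 i j)\<^sup>2)"
    using N V by (intro sum.cong refl energy_reflect) (auto simp: V1_def)
  have c: "(\<Sum>j=1..?n-1. \<Sum>i=1..?n. (2 * v2 i j - v2 (i-1) j - v2 (i+1) j) * v2 i j)
      = (\<Sum>j=1..?n-1. \<Sum>i=0..?n. rho N i * (v2 (i+1) j - v2 i j)\<^sup>2)"
    using N V by (intro sum.cong refl energy_reflect) (auto simp: V2_def)
  have d: "(\<Sum>i=1..?n. \<Sum>j=1..?n-1. (2 * v2 i j - v2 i (j-1) - v2 i (j+1)) * v2 i j)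
      = (\<Sum>i=1..?n. \<Sum>j=1..?n. (v2 i j - v2 i (j-1))\<^sup>2)"
    using N V by (intro sum.cong refl energy_dirichlet) (auto simp: V2_def)
  show ?thesis
    unfolding energy_def neg_lap_def distrib_right sum.distrib b d
    using a c sum.swap[of "\<lambda>i j. (2 * v1 i j - v1 (i-1) j - v1 (i+1) j) * v1 i j" "{1..?n}" "{1..?n-1}"]
      sum.swap[of "\<lambda>i j. (v1 i j - v1 (i-1) j)\<^sup>2" "{1..?n}" "{1..?n}"]
      sum.swap[of "\<lambda>i j. (2 * v2 i j - v2 (i-1) j - v2 (i+1) j) * v2 i j" "{1..?n-1}" "{1..?n}"]
      sum.swap[of "\<lambda>i j. rho N i * (v2 (i+1) j - v2 i j)\<^sup>2" "{1..?n-1}" "{0..?n}"]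
    by linarith
qed

lemma rho_nonneg: "0 \<le> rho N k"
  by (simp add: rho_def)

lemma energy_poincare:
  assumes N: "0 < N" and V: "v1 \<in> V1 N" "v2 \<in> V2 N"
  shows "(\<Sum>i=1..int N - 1. \<Sum>j=1..int N. (v1 i j)\<^sup>2) + (\<Sum>i=1..int N. \<Sum>j=1..int N - 1. (v2 i j)\<^sup>2)
    \<le> (real N)\<^sup>2 * energy N v1 v2"
proof -
  let ?n = "int N"
  have "(\<Sum>j=1..?n. \<Sum>i=1..?n-1. (v1 i j)\<^sup>2) \<le> (\<Sum>j=1..?n. (of_int ?n)\<^sup>2 * (\<Sum>i=1..?n. (v1 i j - v1 (i-1) j)\<^sup>2))"
    using N V by (intro sum_mono poincare_dirichlet) (auto simp: V1_def)
  also have "\<dots> = (real N)\<^sup>2 * (\<Sum>i=1..?n. \<Sum>j=1..?n. (v1 i j - v1 (i-1) j)\<^sup>2)"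
    using sum.swap[of "\<lambda>i j. (v1 i j - v1 (i-1) j)\<^sup>2" "{1..?n}" "{1..?n}"]
    by (simp flip: sum_distrib_left)
  finally have 1: "(\<Sum>i=1..?n-1. \<Sum>j=1..?n. (v1 i j)\<^sup>2) \<le> \<dots>" by (subst sum.swap)
  have "(\<Sum>i=1..?n. \<Sum>j=1..?n-1. (v2 i j)\<^sup>2) \<le> (\<Sum>i=1..?n. (of_int ?n)\<^sup>2 * (\<Sum>j=1..?n. (v2 i j - v2 i (j-1))\<^sup>2))"
    using N V by (intro sum_mono poincare_dirichlet) (auto simp: V2_def)
  then have 2: "(\<Sum>i=1..?n. \<Sum>j=1..?n-1. (v2 i j)\<^sup>2) \<le> (real N)\<^sup>2 * (\<Sum>i=1..?n. \<Sum>j=1..?n. (v2 i j - v2 i (j-1))\<^sup>2)"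
    by (simp add: sum_distrib_left)
  have 3: "0 \<le> (real N)\<^sup>2 * ((\<Sum>i=1..?n-1. \<Sum>j=0..?n. rho N j * (v1 i (j+1) - v1 i j)\<^sup>2)
      + (\<Sum>i=0..?n. \<Sum>j=1..?n-1. rho N i * (v2 (i+1) j - v2 i j)\<^sup>2))"
    by (intro mult_nonneg_nonneg add_nonneg_nonneg sum_nonneg rho_nonneg) auto
  show ?thesis using 1 2 3 unfolding energy_def by (simp add: algebra_simps)
qed

lemma pressure_power:
  fixes Q :: gridfun
  assumes N: "0 < N" and V: "v1 \<in> V1 N" "v2 \<in> V2 N"
  shows "(\<Sum>i=1..int N - 1. \<Sum>j=1..int N. (Q (i+1) j - Q i j) * v1 i j) +
    (\<Sum>i=1..int N. \<Sum>j=1..int N - 1. (Q i (j+1) - Q i j) * v2 i j)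
    = - (\<Sum>i=1..int N. \<Sum>j=1..int N. Q i j * divg v1 v2 i j)"
proof -
  let ?n = "int N"
  have 1: "(\<Sum>j=1..?n. \<Sum>i=1..?n. Q i j * (v1 i j - v1 (i-1) j)) =
      (\<Sum>j=1..?n. - (\<Sum>i=1..?n-1. (Q (i+1) j - Q i j) * v1 i j))"
    using N V by (intro sum.cong refl sum_by_parts_0) (auto simp: V1_def)
  have 2: "(\<Sum>i=1..?n. \<Sum>j=1..?n. Q i j * (v2 i j - v2 i (j-1))) =
      (\<Sum>i=1..?n. - (\<Sum>j=1..?n-1. (Q i (j+1) - Q i j) * v2 i j))"
    using N V by (intro sum.cong refl sum_by_parts_0) (auto simp: V2_def)
  show ?thesis
    using 1 2 sum.swap[of "\<lambda>i j. Q i j * (v1 i j - v1 (i-1) j)" "{1..?n}" "{1..?n}"]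
      sum.swap[of "\<lambda>i j. (Q (i+1) j - Q i j) * v1 i j" "{1..?n}" "{1..?n-1}"]
    unfolding divg_def distrib_left sum.distrib sum_negf by linarith
qed

text \<open>Tests with the constant pressure 1. It is what makes \<open>P\<close> mean-free in the
  stability proof.\<close>

lemma sum_divg:
  assumes N: "0 < N" and V: "v1 \<in> V1 N" "v2 \<in> V2 N"
  shows "(\<Sum>i=1..int N. \<Sum>j=1..int N. divg v1 v2 i j) = 0"
  using pressure_power[OF assms, of "\<lambda>i j. 1"] by simp

lemma square_diff_le: "(a - b)\<^sup>2 \<le> 2 * a\<^sup>2 + 2 * b\<^sup>2" for a b :: real
  using zero_le_power2[of "a + b"] by (simp add: power2_eq_square algebra_simps)

text \<open>In each sum one of the two parts of \<open>\<omega>\<close> carries the weight of the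
  wrong direction. That part is a tangential difference of a component vanishing on the sides in
  question, so only interior vertices remain, where both weights are 1.\<close>

lemma vort_bound:
  assumes N: "0 < N" and V: "v1 \<in> V1 N" "v2 \<in> V2 N"
  defines "\<omega> \<equiv> vort v1 v2"
  shows "(\<Sum>j=1..int N. \<Sum>i=1..int N - 1. (\<omega> i j)\<^sup>2 + (\<omega> i (j-1))\<^sup>2) \<le> 4 * energy N v1 v2" (is ?A)
    and "(\<Sum>i=1..int N. \<Sum>j=1..int N - 1. (\<omega> i j)\<^sup>2 + (\<omega> (i-1) j)\<^sup>2) \<le> 4 * energy N v1 v2" (is ?B)
proof -
  let ?n = "int N"
  define a b where "a i j = (v1 i (j+1) - v1 i j)\<^sup>2" and "b i j = (v2 (i+1) j - v2 i j)\<^sup>2" for i j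
  define X Y where "X = (\<Sum>i=1..?n-1. \<Sum>j=0..?n. rho N j * a i j)"
    and "Y = (\<Sum>i=0..?n. \<Sum>j=1..?n-1. rho N i * b i j)"
  have XY: "X + Y \<le> energy N v1 v2"
    unfolding energy_def X_def Y_def a_def b_def by (simp add: sum_nonneg)
  have \<omega>: "(\<omega> i j)\<^sup>2 \<le> 2 * b i j + 2 * a i j" for i j
    unfolding \<omega>_def vort_def a_def b_def by (rule square_diff_le)
  have split: "{0..?n} = insert 0 (insert ?n {1..?n-1})" using N by auto
  have b0: "b i 0 = 0" "b i ?n = 0" if "i \<in> {1..?n-1}" for i
    using that V by (auto simp: b_def V2_def)
  have a0: "a 0 j = 0" "a ?n j = 0" if "j \<in> {1..?n-1}" for j
    using that V by (auto simp: a_def V1_def)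
  have nn: "0 \<le> rho N k * a i j" "0 \<le> rho N k * b i j" for i j k
    by (auto simp: a_def b_def rho_nonneg)
  have rho1: "rho N k = 1" if "k \<in> {1..?n-1}" for k using that by (auto simp: rho_def)
  have "(\<Sum>i=1..?n-1. \<Sum>j=0..?n. rho N j * b i j) = (\<Sum>i=1..?n-1. \<Sum>j=1..?n-1. rho N i * b i j)"
    unfolding split using N by (intro sum.cong[OF refl, of "{1..?n-1}"]) (simp add: b0 rho1 cong: sum.cong_simp)
  also have "\<dots> \<le> Y"
    unfolding Y_def by (intro sum_mono2 sum_nonneg nn) auto
  finally have Y: "(\<Sum>i=1..?n-1. \<Sum>j=0..?n. rho N j * b i j) \<le> Y" .
  have "(\<Sum>j=1..?n-1. \<Sum>i=0..?n. rho N i * a i j) = (\<Sum>j=1..?n-1. \<Sum>i=1..?n-1. rho N j * a i j)"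
    unfolding split using N by (intro sum.cong[OF refl, of "{1..?n-1}"]) (simp add: a0 rho1 cong: sum.cong_simp)
  also have "\<dots> = (\<Sum>i=1..?n-1. \<Sum>j=1..?n-1. rho N j * a i j)" by (rule sum.swap)
  also have "\<dots> \<le> X"
    unfolding X_def by (intro sum_mono sum_mono2 nn) auto
  finally have X: "(\<Sum>j=1..?n-1. \<Sum>i=0..?n. rho N i * a i j) \<le> X" .
  have "(\<Sum>j=1..?n. \<Sum>i=1..?n-1. (\<omega> i j)\<^sup>2 + (\<omega> i (j-1))\<^sup>2) = 2 * (\<Sum>i=1..?n-1. \<Sum>j=0..?n. rho N j * (\<omega> i j)\<^sup>2)"
    by (subst sum.swap) (simp add: sum_rho(1)[OF N] flip: sum_divide_distrib)
  also have "\<dots> \<le> 2 * (\<Sum>i=1..?n-1. \<Sum>j=0..?n. 2 * (rho N j * b i j) + 2 * (rho N j * a i j))"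
    using mult_left_mono[OF \<omega> rho_nonneg] by (intro mult_left_mono sum_mono) (simp_all add: algebra_simps)
  also have "\<dots> = 4 * (\<Sum>i=1..?n-1. \<Sum>j=0..?n. rho N j * b i j) + 4 * X"
    by (simp add: X_def sum.distrib flip: sum_distrib_left)
  finally show ?A using Y XY by linarith
  have "(\<Sum>i=1..?n. \<Sum>j=1..?n-1. (\<omega> i j)\<^sup>2 + (\<omega> (i-1) j)\<^sup>2) = 2 * (\<Sum>j=1..?n-1. \<Sum>i=0..?n. rho N i * (\<omega> i j)\<^sup>2)"
    by (subst sum.swap) (simp add: sum_rho(1)[OF N] flip: sum_divide_distrib)
  also have "\<dots> \<le> 2 * (\<Sum>j=1..?n-1. \<Sum>i=0..?n. 2 * (rho N i * b i j) + 2 * (rho N i * a i j))"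
    using mult_left_mono[OF \<omega> rho_nonneg] by (intro mult_left_mono sum_mono) (simp_all add: algebra_simps)
  also have "\<dots> = 4 * (\<Sum>j=1..?n-1. \<Sum>i=0..?n. rho N i * b i j) + 4 * (\<Sum>j=1..?n-1. \<Sum>i=0..?n. rho N i * a i j)"
    by (simp add: sum.distrib flip: sum_distrib_left)
  also have "(\<Sum>j=1..?n-1. \<Sum>i=0..?n. rho N i * b i j) = Y" unfolding Y_def by (rule sum.swap)
  finally show ?B using X XY by linarith
qed

text \<open>On the staggered grid the mixed second differences cancel exactly. No boundary condition
  is involved: next to the boundary both sides contain the same ghost values.\<close>

lemma neg_lap_eq_curl_vort:
  "neg_lap v1 i j = (vort v1 v2 i j - vort v1 v2 i (j-1)) - (divg v1 v2 (i+1) j - divg v1 v2 i j)"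
  "neg_lap v2 i j = - (vort v1 v2 i j - vort v1 v2 (i-1) j) - (divg v1 v2 i (j+1) - divg v1 v2 i j)"
  by (simp_all add: neg_lap_def vort_def divg_def)

text \<open>The factor \<open>N^2\<close> in \<open>\<Phi>\<close> arises in two ways that scale
  alike: from the Poincare inequality for the velocity and from \<open>bdist \<le> n\<close> in the
  Caccioppoli estimate.\<close>

lemma unscaled_stability:
  fixes Q f1 f2 v1 v2 :: gridfun
  assumes N: "0 < N" and V: "v1 \<in> V1 N" "v2 \<in> V2 N"
    and mean: "(\<Sum>i=1..int N. \<Sum>j=1..int N. Q i j) = 0"
    and mom1: "\<And>i j. i \<in> {1..int N - 1} \<Longrightarrow> j \<in> {1..int N} \<Longrightarrow> neg_lap v1 i j + (Q (i+1) j - Q i j) = f1 i j"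
    and mom2: "\<And>i j. i \<in> {1..int N} \<Longrightarrow> j \<in> {1..int N - 1} \<Longrightarrow> neg_lap v2 i j + (Q i (j+1) - Q i j) = f2 i j"
  defines "\<Phi> \<equiv> (real N)\<^sup>2 * ((\<Sum>i=1..int N - 1. \<Sum>j=1..int N. (f1 i j)\<^sup>2) + (\<Sum>i=1..int N. \<Sum>j=1..int N - 1. (f2 i j)\<^sup>2))"
    and "\<Gamma> \<equiv> (\<Sum>i=1..int N. \<Sum>j=1..int N. (divg v1 v2 i j)\<^sup>2)"
  shows "energy N v1 v2 \<le> 10 ^ 7 * (\<Phi> + \<Gamma>)"
    and "(\<Sum>i=1..int N. \<Sum>j=1..int N. (Q i j)\<^sup>2) \<le> 10 ^ 14 * (\<Phi> + \<Gamma>)"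
proof -
  let ?n = "int N"
  define g P where "g = divg v1 v2" and "P i j = Q i j - g i j" for i j
  define A X E where "A = energy N v1 v2" and "X = (\<Sum>i=1..?n. \<Sum>j=1..?n. (P i j)\<^sup>2)"
    and "E = wgrad1 ?n P + wgrad2 ?n P"
  define Q2 where "Q2 = (\<Sum>i=1..?n. \<Sum>j=1..?n. (Q i j)\<^sup>2)"
  have n: "1 \<le> ?n" using N by simp
  have nn: "0 \<le> \<Phi>" "0 \<le> \<Gamma>"
    unfolding \<Phi>_def \<Gamma>_def by (intro mult_nonneg_nonneg add_nonneg_nonneg sum_nonneg; simp)+
  have "(\<Sum>i=1..?n. \<Sum>j=1..?n. P i j) = 0"
    using mean sum_divg[OF N V] by (simp add: P_def g_def sum_subtractf)
  then have XE: "X \<le> 1732 * E" unfolding X_def E_def by (rule weighted_poincare[OF n])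
  have "E \<le> 34 * ((of_int ?n)\<^sup>2 * ((\<Sum>j=1..?n. \<Sum>i=1..?n-1. (f1 i j)\<^sup>2) + (\<Sum>i=1..?n. \<Sum>j=1..?n-1. (f2 i j)\<^sup>2)))
    + 160 * ((\<Sum>j=1..?n. \<Sum>i=1..?n-1. (vort v1 v2 i j)\<^sup>2 + (vort v1 v2 i (j-1))\<^sup>2) +
             (\<Sum>i=1..?n. \<Sum>j=1..?n-1. (vort v1 v2 i j)\<^sup>2 + (vort v1 v2 (i-1) j)\<^sup>2))"
    unfolding E_def
  proof (rule caccioppoli[OF n])
    show "P (i+1) j - P i j = f1 i j - (vort v1 v2 i j - vort v1 v2 i (j-1))"
      if "i \<in> {1..?n-1}" "j \<in> {1..?n}" for i j
      using mom1[OF that] neg_lap_eq_curl_vort(1)[of v1 i j v2] by (simp add: P_def g_def)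
    show "P i (j+1) - P i j = f2 i j + (vort v1 v2 i j - vort v1 v2 (i-1) j)"
      if "i \<in> {1..?n}" "j \<in> {1..?n-1}" for i j
      using mom2[OF that] neg_lap_eq_curl_vort(2)[of v2 i j v1] by (simp add: P_def g_def)
  qed
  also have "(of_int ?n)\<^sup>2 * ((\<Sum>j=1..?n. \<Sum>i=1..?n-1. (f1 i j)\<^sup>2) + (\<Sum>i=1..?n. \<Sum>j=1..?n-1. (f2 i j)\<^sup>2)) = \<Phi>"
    unfolding \<Phi>_def using sum.swap[of "\<lambda>i j. (f1 i j)\<^sup>2" "{1..?n}" "{1..?n-1}"] by simp
  finally have EA: "E \<le> 34 * \<Phi> + 1280 * A"
    using vort_bound[OF N V] by (simp add: A_def)
  have QX: "Q2 \<le> 2 * X + 2 * \<Gamma>"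
  proof -
    have "Q2 \<le> (\<Sum>i=1..?n. \<Sum>j=1..?n. 2 * (P i j)\<^sup>2 + 2 * (g i j)\<^sup>2)"
      unfolding Q2_def
    proof (intro sum_mono)
      show "(Q i j)\<^sup>2 \<le> 2 * (P i j)\<^sup>2 + 2 * (g i j)\<^sup>2" for i j
        using square_diff_le[of "P i j" "- g i j"] by (simp add: P_def)
    qed
    then show ?thesis by (simp add: X_def \<Gamma>_def g_def sum.distrib flip: sum_distrib_left)
  qed
  \<comment> \<open>The weight \<open>17735680 = 8 * (1732 * 1280)\<close> below makes the \<open>Q2\<close> term absorbable, because
    \<open>XE\<close>, \<open>EA\<close> and \<open>QX\<close> give \<open>Q2 \<le> 2 * (1732 * 1280) * (\<Phi> + A) + 2 * \<Gamma>\<close>.\<close>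
  have fv: "f * v \<le> (real N)\<^sup>2 * f\<^sup>2 + v\<^sup>2 / (4 * (real N)\<^sup>2)" for f v
    using zero_le_power2[of "real N * f - v / (2 * real N)"] N
    by (simp add: power2_diff power_mult_distrib power_divide)
  have "A = (\<Sum>i=1..?n-1. \<Sum>j=1..?n. (f1 i j - (Q (i+1) j - Q i j)) * v1 i j) +
     (\<Sum>i=1..?n. \<Sum>j=1..?n-1. (f2 i j - (Q i (j+1) - Q i j)) * v2 i j)"
    unfolding A_def energy_eq[OF N V]
  proof (intro arg_cong2[where f = "(+)"] sum.cong refl)
    show "neg_lap v1 i j * v1 i j = (f1 i j - (Q (i+1) j - Q i j)) * v1 i j"
      if "i \<in> {1..?n-1}" "j \<in> {1..?n}" for i j
      by (simp flip: mom1[OF that])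
    show "neg_lap v2 i j * v2 i j = (f2 i j - (Q i (j+1) - Q i j)) * v2 i j"
      if "i \<in> {1..?n}" "j \<in> {1..?n-1}" for i j
      by (simp flip: mom2[OF that])
  qed
  also have "\<dots> = (\<Sum>i=1..?n-1. \<Sum>j=1..?n. f1 i j * v1 i j) + (\<Sum>i=1..?n. \<Sum>j=1..?n-1. f2 i j * v2 i j)
     + (\<Sum>i=1..?n. \<Sum>j=1..?n. Q i j * g i j)"
    using pressure_power[OF N V, of Q] by (simp add: left_diff_distrib sum_subtractf g_def)
  also have "\<dots> \<le> (\<Sum>i=1..?n-1. \<Sum>j=1..?n. (real N)\<^sup>2 * (f1 i j)\<^sup>2 + (v1 i j)\<^sup>2 / (4 * (real N)\<^sup>2))
     + (\<Sum>i=1..?n. \<Sum>j=1..?n-1. (real N)\<^sup>2 * (f2 i j)\<^sup>2 + (v2 i j)\<^sup>2 / (4 * (real N)\<^sup>2))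
     + (\<Sum>i=1..?n. \<Sum>j=1..?n. (Q i j)\<^sup>2 / 17735680 + 4433920 * (g i j)\<^sup>2)"
  proof (intro add_mono sum_mono fv)
    \<comment> \<open>Young's inequality with \<open>c = 17735680\<close>; the other numbers are
      \<open>c/4\<close> and \<open>c/2\<close>.\<close>
    show "Q i j * g i j \<le> (Q i j)\<^sup>2 / 17735680 + 4433920 * (g i j)\<^sup>2" for i j
      using zero_le_power2[of "Q i j - 8867840 * g i j"]
      by (simp add: power2_diff power_mult_distrib field_simps)
  qed
  also have "\<dots> = \<Phi> + ((\<Sum>i=1..?n-1. \<Sum>j=1..?n. (v1 i j)\<^sup>2) + (\<Sum>i=1..?n. \<Sum>j=1..?n-1. (v2 i j)\<^sup>2)) / (4 * (real N)\<^sup>2)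
      + Q2 / 17735680 + 4433920 * \<Gamma>"
    by (simp add: \<Phi>_def \<Gamma>_def Q2_def g_def sum.distrib distrib_left add_divide_distrib sum_distrib_left sum_divide_distrib)
  also have "((\<Sum>i=1..?n-1. \<Sum>j=1..?n. (v1 i j)\<^sup>2) + (\<Sum>i=1..?n. \<Sum>j=1..?n-1. (v2 i j)\<^sup>2)) / (4 * (real N)\<^sup>2) \<le> A / 4"
    using energy_poincare[OF N V] N by (simp add: A_def field_simps)
  finally have A: "A \<le> \<Phi> + A / 4 + Q2 / 17735680 + 4433920 * \<Gamma>" by simp
  \<comment> \<open>The term \<open>Q2 / 17735680\<close> costs another \<open>A / 4\<close>, so
    \<open>A / 2\<close> survives on the left; doubling 4433920 stays below \<open>10 ^ 7\<close>.
    Inserting this into the bound for \<open>Q2\<close> multiplies by about 4433920 once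
    more.\<close>
  show "energy N v1 v2 \<le> 10 ^ 7 * (\<Phi> + \<Gamma>)" "Q2 \<le> 10 ^ 14 * (\<Phi> + \<Gamma>)"
    using A QX XE EA nn unfolding A_def[symmetric] by simp_all
qed

section \<open>Stability in the mesh-dependent norms\<close>

lemma seminorm_H1_sq:
  assumes N: "0 < N"
  shows "(seminorm_H1 N v1 v2)\<^sup>2 = energy N v1 v2"
proof -
  \<comment> \<open>In two dimensions the area factor \<open>h^2\<close> cancels the squared
    denominator of the difference quotients.\<close>
  have scale: "(1 / real N)\<^sup>2 * (\<Sum>i\<in>A. \<Sum>j\<in>B. c i j * (w i j / (1 / real N))\<^sup>2) = (\<Sum>i\<in>A. \<Sum>j\<in>B. c i j * (w i j)\<^sup>2)"
    for A B :: "int set" and c w :: gridfun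
    using N by (simp add: sum_distrib_left power_mult_distrib power_divide)
  show ?thesis
    unfolding seminorm_H1_def energy_def norm_M_def norm_W1_def norm_W2_def
      dminus1_def dminus2_def dplus1_def dplus2_def
    using scale[of "\<lambda>i j. 1"] scale[of "\<lambda>i j. rho N j"] scale[of "\<lambda>i j. rho N i"]
    by (simp add: sum_nonneg rho_nonneg)
qed

lemma norm_V_le_seminorm_H1:
  assumes N: "0 < N" and V: "v1 \<in> V1 N" "v2 \<in> V2 N"
  shows "norm_V N v1 v2 \<le> seminorm_H1 N v1 v2"
proof -
  have "(norm_V N v1 v2)\<^sup>2 = ((\<Sum>i=1..int N - 1. \<Sum>j=1..int N. (v1 i j)\<^sup>2) + (\<Sum>i=1..int N. \<Sum>j=1..int N - 1. (v2 i j)\<^sup>2)) / (real N)\<^sup>2"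
    by (simp add: norm_V_def norm_V1_def norm_V2_def sum_nonneg power_divide add_divide_distrib)
  also have "\<dots> \<le> (seminorm_H1 N v1 v2)\<^sup>2"
    using energy_poincare[OF N V] N by (simp add: seminorm_H1_sq field_simps)
  finally show ?thesis by (rule power2_le_imp_le) (simp add: seminorm_H1_def)
qed

lemma mac_stability:
  assumes N: "0 < N" and V: "v1 \<in> V1 N" "v2 \<in> V2 N" and q: "q \<in> M_h N"
    and mac: "mac_equations N F1 F2 G v1 v2 q"
  shows "(seminorm_H1 N v1 v2)\<^sup>2 \<le> 10 ^ 7 * ((norm_V N F1 F2)\<^sup>2 + (norm_M N G)\<^sup>2)"
    and "(norm_M N q)\<^sup>2 \<le> 10 ^ 14 * ((norm_V N F1 F2)\<^sup>2 + (norm_M N G)\<^sup>2)"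
proof -
  let ?n = "int N"
  define h where "h = 1 / real N"
  have h: "0 < h" "real N * h = 1" using N by (auto simp: h_def)
  have lap: "neg_lap v i j = - (h\<^sup>2 * lap_h h v i j)" for v i j
    using h by (simp add: neg_lap_def lap_h_def dplus1_def dplus2_def dminus1_def dminus2_def
        power2_eq_square field_simps)
  have mom1: "neg_lap v1 i j + (h * q (i+1) j - h * q i j) = h\<^sup>2 * F1 i j"
    if "i \<in> {1..?n-1}" "j \<in> {1..?n}" for i j
  proof -
    have "- lap_h h v1 i j + dplus1 h q i j = F1 i j"
      using mac that by (simp add: mac_equations_def Let_def h_def)
    then show ?thesis unfolding lap using h by (simp add: dplus1_def power2_eq_square field_simps)
  qed
  have mom2: "neg_lap v2 i j + (h * q i (j+1) - h * q i j) = h\<^sup>2 * F2 i j"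
    if "i \<in> {1..?n}" "j \<in> {1..?n-1}" for i j
  proof -
    have "- lap_h h v2 i j + dplus2 h q i j = F2 i j"
      using mac that by (simp add: mac_equations_def Let_def h_def)
    then show ?thesis unfolding lap using h by (simp add: dplus2_def power2_eq_square field_simps)
  qed
  have div: "divg v1 v2 i j = h * G i j" if "i \<in> {1..?n}" "j \<in> {1..?n}" for i j
  proof -
    have "dminus1 h v1 i j + dminus2 h v2 i j = G i j"
      using mac that by (simp add: mac_equations_def Let_def h_def)
    then show ?thesis using h
      by (auto simp: divg_def dminus1_def dminus2_def add_divide_distrib[symmetric] divide_eq_eq mult.commute)
  qed
  have mean: "(\<Sum>i=1..?n. \<Sum>j=1..?n. h * q i j) = 0"
    using q by (simp add: M_h_def flip: sum_distrib_left)
  have scale: "(real N)\<^sup>2 * (h\<^sup>2 * x)\<^sup>2 = h\<^sup>2 * x\<^sup>2" for x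
  proof -
    have "(real N)\<^sup>2 * (h\<^sup>2 * x)\<^sup>2 = (real N * h)\<^sup>2 * (h\<^sup>2 * x\<^sup>2)"
      by (simp add: power2_eq_square algebra_simps)
    then show ?thesis by (simp add: h)
  qed
  have \<Phi>: "(real N)\<^sup>2 * ((\<Sum>i=1..?n-1. \<Sum>j=1..?n. (h\<^sup>2 * F1 i j)\<^sup>2) + (\<Sum>i=1..?n. \<Sum>j=1..?n-1. (h\<^sup>2 * F2 i j)\<^sup>2))
      = (norm_V N F1 F2)\<^sup>2"
    by (simp add: norm_V_def norm_V1_def norm_V2_def sum_nonneg distrib_left sum_distrib_left scale flip: h_def)
  have \<Gamma>: "(\<Sum>i=1..?n. \<Sum>j=1..?n. (divg v1 v2 i j)\<^sup>2) = (norm_M N G)\<^sup>2"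
    by (simp add: norm_M_def sum_nonneg sum_distrib_left div power_mult_distrib flip: h_def)
  have Q: "(\<Sum>i=1..?n. \<Sum>j=1..?n. (h * q i j)\<^sup>2) = (norm_M N q)\<^sup>2"
    by (simp add: norm_M_def sum_nonneg sum_distrib_left power_mult_distrib flip: h_def)
  note st = unscaled_stability[where Q = "\<lambda>i j. h * q i j" and ?f1.0 = "\<lambda>i j. h\<^sup>2 * F1 i j"
      and ?f2.0 = "\<lambda>i j. h\<^sup>2 * F2 i j", OF N V mean mom1 mom2, unfolded \<Phi> \<Gamma> Q]
  show "(seminorm_H1 N v1 v2)\<^sup>2 \<le> 10 ^ 7 * ((norm_V N F1 F2)\<^sup>2 + (norm_M N G)\<^sup>2)"
    unfolding seminorm_H1_sq[OF N] by (rule st(1))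
  show "(norm_M N q)\<^sup>2 \<le> 10 ^ 14 * ((norm_V N F1 F2)\<^sup>2 + (norm_M N G)\<^sup>2)"
    by (rule st(2))
qed

lemma double_sum_square_le:
  fixes w :: gridfun
  assumes "\<And>i j. i \<in> A \<Longrightarrow> j \<in> B \<Longrightarrow> \<bar>w i j\<bar> \<le> b" and "0 < N"
    and "A \<subseteq> {1..int N}" "B \<subseteq> {1..int N}"
  shows "(1 / real N)\<^sup>2 * (\<Sum>i\<in>A. \<Sum>j\<in>B. (w i j)\<^sup>2) \<le> b\<^sup>2"
proof -
  have "(\<Sum>i\<in>A. \<Sum>j\<in>B. (w i j)\<^sup>2) \<le> (\<Sum>i\<in>A. \<Sum>j\<in>B. b\<^sup>2)"
    by (intro sum_mono) (use assms(1) in \<open>metis abs_ge_zero power2_abs power_mono\<close>)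
  also have "\<dots> \<le> (\<Sum>i=1..int N. \<Sum>j\<in>B. b\<^sup>2)"
    using assms by (intro sum_mono2) (auto intro!: mult_nonneg_nonneg)
  also have "\<dots> \<le> (\<Sum>i=1..int N. \<Sum>j=1..int N. b\<^sup>2)"
    using assms by (intro sum_mono sum_mono2) auto
  finally show ?thesis using assms(2) by (simp add: power2_eq_square field_simps)
qed

subsection \<open>The error estimate\<close>

text \<open>Without boundedness the real \<open>Sup\<close> says nothing about the elements of the
  set; sign and monotonicity of \<open>sup_norm\<close> rest on this.\<close>

lemma bdd_above_pd:
  assumes "pw_smooth \<Omega>p k v" "r \<le> k"
  shows "bdd_above {\<bar>pd s l v X\<bar> | s l X. s + l \<le> r \<and> X \<in> \<Omega>p \<union> Omega_minus \<Omega>p}"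
proof -
  let ?D = "\<Omega>p \<union> Omega_minus \<Omega>p" and ?I = "{(s, l). s + l \<le> r}"
  have "?I \<subseteq> {..r} \<times> {..r}" by auto
  then have "finite ?I" by (rule finite_subset) simp
  moreover have "bounded (pd s l v ` ?D)" if "(s, l) \<in> ?I" for s l
    using assms that unfolding pw_smooth_def by (auto dest!: conjunct1[OF conjunct2])
  ultimately have "bounded (\<Union>(s, l)\<in>?I. pd s l v ` ?D)" by (intro bounded_UN) auto
  then obtain b where "\<And>x. x \<in> (\<Union>(s, l)\<in>?I. pd s l v ` ?D) \<Longrightarrow> \<bar>x\<bar> \<le> b"
    by (auto simp: bounded_iff)
  then show ?thesis by (intro bdd_aboveI[of _ b]) auto
qed

lemma sup_norm_nonneg:
  assumes "pw_smooth \<Omega>p k v" "r \<le> k" "\<Omega>p \<noteq> {}"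
  shows "0 \<le> sup_norm \<Omega>p r v"
proof -
  from assms(3) obtain X where "X \<in> \<Omega>p" by blast
  then have "\<bar>pd 0 0 v X\<bar> \<in> {\<bar>pd s l v X\<bar> | s l X. s + l \<le> r \<and> X \<in> \<Omega>p \<union> Omega_minus \<Omega>p}"
    by (intro CollectI exI[of _ 0] exI[of _ X]) simp
  then have "\<bar>pd 0 0 v X\<bar> \<le> sup_norm \<Omega>p r v"
    unfolding sup_norm_def by (rule cSup_upper[OF _ bdd_above_pd[OF assms(1,2)]])
  then show ?thesis by linarith
qed

lemma sup_norm_mono:
  assumes "pw_smooth \<Omega>p k v" "r \<le> r'" "r' \<le> k" "\<Omega>p \<noteq> {}"
  shows "sup_norm \<Omega>p r v \<le> sup_norm \<Omega>p r' v"
  unfolding sup_norm_def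
proof (rule cSup_subset_mono)
  from assms(4) obtain X where "X \<in> \<Omega>p" by blast
  then have "\<bar>pd 0 0 v X\<bar> \<in> {\<bar>pd s l v X\<bar> | s l X. s + l \<le> r \<and> X \<in> \<Omega>p \<union> Omega_minus \<Omega>p}"
    by (intro CollectI exI[of _ 0] exI[of _ X]) simp
  then show "{\<bar>pd s l v X\<bar> | s l X. s + l \<le> r \<and> X \<in> \<Omega>p \<union> Omega_minus \<Omega>p} \<noteq> {}" by blast
qed (use assms bdd_above_pd[OF assms(1,3)] in force)+

section \<open>Errors in the discrete spaces and the effect of ghost values\<close>

lemma err_u1_in_V1:
  assumes N: "0 < N" and v: "v \<in> V1 N"
    and bc: "\<And>y. y \<in> {0..1} \<Longrightarrow> ut (0, y) = 0" "\<And>y. y \<in> {0..1} \<Longrightarrow> ut (1, y) = 0"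
  shows "err_u1 N v ut \<in> V1 N"
proof -
  \<comment> \<open>The indices \<open>j = 0\<close> and \<open>j = N + 1\<close> reduce to
    \<open>1\<close> and \<open>N\<close> by the reflection in \<open>err_u1\<close>.\<close>
  have "v 0 j - ut (node_u1 (1 / real N) 0 j) = 0 \<and> v (int N) j - ut (node_u1 (1 / real N) (int N) j) = 0"
    if "j \<in> {1..int N}" for j
  proof -
    have "(of_int j - 1/2) * (1 / real N) \<in> {0..1}" using that N by (auto simp: field_simps)
    then show ?thesis using v bc that N by (auto simp: V1_def node_u1_def)
  qed
  then show ?thesis using N by (auto simp: V1_def err_u1_def)
qed

lemma err_u2_in_V2:
  assumes N: "0 < N" and v: "v \<in> V2 N"
    and bc: "\<And>x. x \<in> {0..1} \<Longrightarrow> ut (x, 0) = 0" "\<And>x. x \<in> {0..1} \<Longrightarrow> ut (x, 1) = 0"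
  shows "err_u2 N v ut \<in> V2 N"
proof -
  have "v i 0 - ut (node_u2 (1 / real N) i 0) = 0 \<and> v i (int N) - ut (node_u2 (1 / real N) i (int N)) = 0"
    if "i \<in> {1..int N}" for i
  proof -
    have "(of_int i - 1/2) * (1 / real N) \<in> {0..1}" using that N by (auto simp: field_simps)
    then show ?thesis using v bc that N by (auto simp: V2_def node_u2_def)
  qed
  then show ?thesis using N by (auto simp: V2_def err_u2_def)
qed

lemma err_p_in_M_h:
  assumes "0 < N"
  shows "err_p N q pt \<in> M_h N"
  using assms by (simp add: M_h_def err_p_def Let_def sum_subtractf power2_eq_square)

text \<open>A ghost neighbour enters the five-point stencil with coefficient \<open>1 / h^2\<close>.
  Both vertical neighbours are ghosts only if \<open>n = 1\<close>; the factor 2 covers this case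
  too.\<close>

lemma lap_h_ghost2:
  assumes h: "0 < h" and eq: "\<And>i j. j \<noteq> 0 \<Longrightarrow> j \<noteq> n + 1 \<Longrightarrow> e i j = r i j"
    and "j \<in> {1..n}" and b: "\<bar>e i 0 - r i 0\<bar> \<le> b" "\<bar>e i (n+1) - r i (n+1)\<bar> \<le> b"
  shows "\<bar>lap_h h e i j - lap_h h r i j\<bar> \<le> 2 * b / h\<^sup>2"
proof -
  have lap: "lap_h h e i j - lap_h h r i j = ((e i (j-1) - r i (j-1)) + (e i (j+1) - r i (j+1))) / h\<^sup>2"
    using h assms(3) eq[of j] by (simp add: lap_h_def dplus1_def dplus2_def dminus1_def dminus2_def
        power2_eq_square field_simps)
  have b0: "0 \<le> b" using b(1) by linarith
  have "\<bar>e i (j-1) - r i (j-1)\<bar> \<le> b"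
  proof (cases "j = 1")
    case False
    then show ?thesis using eq[of "j-1" i] assms(3) b0 by simp
  qed (use b(1) in simp)
  moreover have "\<bar>e i (j+1) - r i (j+1)\<bar> \<le> b"
  proof (cases "j = n")
    case False
    then show ?thesis using eq[of "j+1" i] assms(3) b0 by simp
  qed (use b(2) in simp)
  ultimately have "\<bar>(e i (j-1) - r i (j-1)) + (e i (j+1) - r i (j+1))\<bar> \<le> b + b"
    by (intro order_trans[OF abs_triangle_ineq] add_mono)
  then show ?thesis using h by (simp add: lap abs_divide divide_right_mono)
qed

lemma lap_h_transpose: "lap_h h (\<lambda>i j. v j i) i j = lap_h h v j i"
  by (simp add: lap_h_def dplus1_def dplus2_def dminus1_def dminus2_def)

lemma lap_h_ghost1:
  assumes h: "0 < h" and eq: "\<And>i j. i \<noteq> 0 \<Longrightarrow> i \<noteq> n + 1 \<Longrightarrow> e i j = r i j"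
    and "i \<in> {1..n}" and b: "\<bar>e 0 j - r 0 j\<bar> \<le> b" "\<bar>e (n+1) j - r (n+1) j\<bar> \<le> b"
  shows "\<bar>lap_h h e i j - lap_h h r i j\<bar> \<le> 2 * b / h\<^sup>2"
  using lap_h_ghost2[of h n "\<lambda>i j. e j i" "\<lambda>i j. r j i" i j b] assms
  by (simp add: lap_h_transpose[of h e] lap_h_transpose[of h r])

lemma dplus1_err_p: "dplus1 h (err_p N q pt) i j
    = dplus1 h q i j - dplus1 h (\<lambda>i j. pt (node_p (1 / real N) i j)) i j"
  by (simp add: dplus1_def err_p_def Let_def flip: diff_divide_distrib)

lemma dplus2_err_p: "dplus2 h (err_p N q pt) i j
    = dplus2 h q i j - dplus2 h (\<lambda>i j. pt (node_p (1 / real N) i j)) i j"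
  by (simp add: dplus2_def err_p_def Let_def flip: diff_divide_distrib)

lemma lap_h_diff: "lap_h h (\<lambda>i j. v i j - w i j) i j = lap_h h v i j - lap_h h w i j"
  by (cases "h = 0") (simp_all add: lap_h_def dplus1_def dplus2_def dminus1_def dminus2_def field_simps)

text \<open>The true error does not satisfy the reflection rule, and enforcing it changes the ghost values
  by \<open>O(h\<^sup>4)\<close>. Next to the boundary this perturbs the discrete Laplacian by only \<open>O(h\<^sup>2)\<close>.\<close>

lemma lap_err_u1:
  fixes v ut h N
  defines "h \<equiv> 1 / real N"
  assumes N: "0 < N" and v: "v \<in> V1 N"
    and ghost: "\<And>x. x \<in> {0..1} \<Longrightarrow> \<bar>ut (x, - h / 2) + ut (x, h / 2)\<bar> \<le> b"
      "\<And>x. x \<in> {0..1} \<Longrightarrow> \<bar>ut (x, 1 - h / 2) + ut (x, 1 + h / 2)\<bar> \<le> b"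
    and ij: "i \<in> {1..int N - 1}" "j \<in> {1..int N}"
  shows "\<bar>lap_h h (err_u1 N v ut) i j - (lap_h h v i j - lap_h h (\<lambda>i j. ut (node_u1 h i j)) i j)\<bar> \<le> 2 * b / h\<^sup>2"
proof -
  let ?x = "of_int i * h"
  have h: "0 < h" "real N * h = 1" using N by (auto simp: h_def)
  have x: "?x \<in> {0..1}" using ij N by (auto simp: h_def field_simps)
  have y: "node_u1 h i 0 = (?x, - h / 2)" "node_u1 h i 1 = (?x, h / 2)"
    "node_u1 h i (int N) = (?x, 1 - h / 2)" "node_u1 h i (int N + 1) = (?x, 1 + h / 2)"
    using h by (auto simp: node_u1_def algebra_simps)
  have "v i 0 = - v i 1" "v i (int N + 1) = - v i (int N)" using v ij by (auto simp: V1_def)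
  then have "err_u1 N v ut i 0 - (v i 0 - ut (node_u1 h i 0)) = ut (?x, - h / 2) + ut (?x, h / 2)"
    and "err_u1 N v ut i (int N + 1) - (v i (int N + 1) - ut (node_u1 h i (int N + 1)))
      = ut (?x, 1 - h / 2) + ut (?x, 1 + h / 2)"
    by (simp_all add: err_u1_def y flip: h_def)
  then show ?thesis
    unfolding lap_h_diff[symmetric, of h v _ _ "\<lambda>i j. ut (node_u1 h i j)"] using ghost[OF x]
    by (intro lap_h_ghost2[of h "int N"] h ij) (simp_all add: err_u1_def flip: h_def)
qed

lemma lap_err_u2:
  fixes v ut h N
  defines "h \<equiv> 1 / real N"
  assumes N: "0 < N" and v: "v \<in> V2 N"
    and ghost: "\<And>y. y \<in> {0..1} \<Longrightarrow> \<bar>ut (- h / 2, y) + ut (h / 2, y)\<bar> \<le> b"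
      "\<And>y. y \<in> {0..1} \<Longrightarrow> \<bar>ut (1 - h / 2, y) + ut (1 + h / 2, y)\<bar> \<le> b"
    and ij: "i \<in> {1..int N}" "j \<in> {1..int N - 1}"
  shows "\<bar>lap_h h (err_u2 N v ut) i j - (lap_h h v i j - lap_h h (\<lambda>i j. ut (node_u2 h i j)) i j)\<bar> \<le> 2 * b / h\<^sup>2"
proof -
  let ?y = "of_int j * h"
  have h: "0 < h" "real N * h = 1" using N by (auto simp: h_def)
  have y: "?y \<in> {0..1}" using ij N by (auto simp: h_def field_simps)
  have x: "node_u2 h 0 j = (- h / 2, ?y)" "node_u2 h 1 j = (h / 2, ?y)"
    "node_u2 h (int N) j = (1 - h / 2, ?y)" "node_u2 h (int N + 1) j = (1 + h / 2, ?y)"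
    using h by (auto simp: node_u2_def algebra_simps)
  have "v 0 j = - v 1 j" "v (int N + 1) j = - v (int N) j" using v ij by (auto simp: V2_def)
  then have "err_u2 N v ut 0 j - (v 0 j - ut (node_u2 h 0 j)) = ut (- h / 2, ?y) + ut (h / 2, ?y)"
    and "err_u2 N v ut (int N + 1) j - (v (int N + 1) j - ut (node_u2 h (int N + 1) j))
      = ut (1 - h / 2, ?y) + ut (1 + h / 2, ?y)"
    by (simp_all add: err_u2_def x flip: h_def)
  then show ?thesis
    unfolding lap_h_diff[symmetric, of h v _ _ "\<lambda>i j. ut (node_u2 h i j)"] using ghost[OF y]
    by (intro lap_h_ghost1[of h "int N"] h ij) (simp_all add: err_u2_def flip: h_def)
qed

text \<open>One number \<open>b\<close> measures all data errors. The ghost mismatch is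
  \<open>h^2 * b\<close> because the Laplacian divides it by \<open>h^2\<close>; the divergence
  residual may be \<open>2 * b\<close> because its bound adds the norms of two components.\<close>

lemma mac_error_estimate:
  fixes N :: nat and v1 v2 q u1t u2t pt F1 F2 G R1 R2 R h b
  defines "h \<equiv> 1 / real N"
  defines "e1 \<equiv> err_u1 N v1 u1t" and "e2 \<equiv> err_u2 N v2 u2t" and "ep \<equiv> err_p N q pt"
  assumes N: "0 < N" and V: "v1 \<in> V1 N" "v2 \<in> V2 N"
    and num: "mac_equations N F1 F2 G v1 v2 q"
    and aux: "mac_equations N (\<lambda>i j. F1 i j + R1 i j) (\<lambda>i j. F2 i j + R2 i j) (\<lambda>i j. G i j + R i j)
      (\<lambda>i j. u1t (node_u1 h i j)) (\<lambda>i j. u2t (node_u2 h i j)) (\<lambda>i j. pt (node_p h i j))"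
    and R1: "\<And>i j. i \<in> {1..int N - 1} \<Longrightarrow> j \<in> {1..int N} \<Longrightarrow> \<bar>R1 i j\<bar> \<le> b"
    and R2: "\<And>i j. i \<in> {1..int N} \<Longrightarrow> j \<in> {1..int N - 1} \<Longrightarrow> \<bar>R2 i j\<bar> \<le> b"
    and R: "\<And>i j. i \<in> {1..int N} \<Longrightarrow> j \<in> {1..int N} \<Longrightarrow> \<bar>R i j\<bar> \<le> 2 * b"
    and ghost1: "\<And>x. x \<in> {0..1} \<Longrightarrow> \<bar>u1t (x, - h / 2) + u1t (x, h / 2)\<bar> \<le> h\<^sup>2 * b"
      "\<And>x. x \<in> {0..1} \<Longrightarrow> \<bar>u1t (x, 1 - h / 2) + u1t (x, 1 + h / 2)\<bar> \<le> h\<^sup>2 * b"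
    and ghost2: "\<And>y. y \<in> {0..1} \<Longrightarrow> \<bar>u2t (- h / 2, y) + u2t (h / 2, y)\<bar> \<le> h\<^sup>2 * b"
      "\<And>y. y \<in> {0..1} \<Longrightarrow> \<bar>u2t (1 - h / 2, y) + u2t (1 + h / 2, y)\<bar> \<le> h\<^sup>2 * b"
    and bc1: "\<And>y. y \<in> {0..1} \<Longrightarrow> u1t (0, y) = 0" "\<And>y. y \<in> {0..1} \<Longrightarrow> u1t (1, y) = 0"
    and bc2: "\<And>x. x \<in> {0..1} \<Longrightarrow> u2t (x, 0) = 0" "\<And>x. x \<in> {0..1} \<Longrightarrow> u2t (x, 1) = 0"
    and b: "0 \<le> b"
  shows "e1 \<in> V1 N" "e2 \<in> V2 N" "ep \<in> M_h N"
    and "seminorm_H1 N e1 e2 \<le> 10 ^ 8 * b" "norm_V N e1 e2 \<le> 10 ^ 8 * b" "norm_M N ep \<le> 10 ^ 8 * b"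
proof -
  let ?n = "int N"
  have h: "0 < h" using N by (simp add: h_def)
  show e: "e1 \<in> V1 N" "e2 \<in> V2 N" "ep \<in> M_h N"
    unfolding e1_def e2_def ep_def
    by (rule err_u1_in_V1 err_u2_in_V2 err_p_in_M_h; use N V bc1 bc2 in simp)+
  \<comment> \<open>With the right-hand sides defined as whatever the errors produce, the scheme
    holds trivially and only their size is at stake.\<close>
  define E1 E2 D where "E1 i j = - lap_h h e1 i j + dplus1 h ep i j"
    and "E2 i j = - lap_h h e2 i j + dplus2 h ep i j"
    and "D i j = dminus1 h e1 i j + dminus2 h e2 i j" for i j
  have mac: "mac_equations N E1 E2 D e1 e2 ep"
    by (simp add: mac_equations_def Let_def E1_def E2_def D_def flip: h_def)
  have E1: "\<bar>E1 i j\<bar> \<le> 3 * b" if ij: "i \<in> {1..?n-1}" "j \<in> {1..?n}" for i j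
  proof -
    have "- lap_h h v1 i j + dplus1 h q i j = F1 i j"
      "- lap_h h (\<lambda>i j. u1t (node_u1 h i j)) i j + dplus1 h (\<lambda>i j. pt (node_p h i j)) i j = F1 i j + R1 i j"
      using num aux ij by (auto simp: mac_equations_def Let_def h_def)
    moreover have "\<bar>lap_h h e1 i j - (lap_h h v1 i j - lap_h h (\<lambda>i j. u1t (node_u1 h i j)) i j)\<bar> \<le> 2 * b"
      using lap_err_u1[OF N V(1), of u1t "h\<^sup>2 * b" i j] ghost1 ij h by (simp add: e1_def flip: h_def)
    moreover have "dplus1 h ep i j = dplus1 h q i j - dplus1 h (\<lambda>i j. pt (node_p h i j)) i j"
      by (simp add: ep_def dplus1_err_p flip: h_def)
    ultimately show ?thesis using R1[OF ij] unfolding E1_def by linarith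
  qed
  have E2: "\<bar>E2 i j\<bar> \<le> 3 * b" if ij: "i \<in> {1..?n}" "j \<in> {1..?n-1}" for i j
  proof -
    have "- lap_h h v2 i j + dplus2 h q i j = F2 i j"
      "- lap_h h (\<lambda>i j. u2t (node_u2 h i j)) i j + dplus2 h (\<lambda>i j. pt (node_p h i j)) i j = F2 i j + R2 i j"
      using num aux ij by (auto simp: mac_equations_def Let_def h_def)
    moreover have "\<bar>lap_h h e2 i j - (lap_h h v2 i j - lap_h h (\<lambda>i j. u2t (node_u2 h i j)) i j)\<bar> \<le> 2 * b"
      using lap_err_u2[OF N V(2), of u2t "h\<^sup>2 * b" i j] ghost2 ij h by (simp add: e2_def flip: h_def)
    moreover have "dplus2 h ep i j = dplus2 h q i j - dplus2 h (\<lambda>i j. pt (node_p h i j)) i j"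
      by (simp add: ep_def dplus2_err_p flip: h_def)
    ultimately show ?thesis using R2[OF ij] unfolding E2_def by linarith
  qed
  \<comment> \<open>The divergence stencil of a cell uses no ghost value, so no mismatch arises
    here.\<close>
  have D: "\<bar>D i j\<bar> \<le> 3 * b" if ij: "i \<in> {1..?n}" "j \<in> {1..?n}" for i j
  proof -
    let ?w1 = "\<lambda>i j. u1t (node_u1 h i j)" and ?w2 = "\<lambda>i j. u2t (node_u2 h i j)"
    have "dminus1 h v1 i j + dminus2 h v2 i j = G i j"
      "dminus1 h ?w1 i j + dminus2 h ?w2 i j = G i j + R i j"
      using num aux ij by (auto simp: mac_equations_def Let_def h_def)
    moreover have "dminus1 h e1 i j = dminus1 h v1 i j - dminus1 h ?w1 i j"
      "dminus2 h e2 i j = dminus2 h v2 i j - dminus2 h ?w2 i j"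
      using ij by (simp_all add: dminus1_def dminus2_def e1_def e2_def err_u1_def err_u2_def
          flip: h_def diff_divide_distrib)
    ultimately show ?thesis using R[OF ij] b unfolding D_def by linarith
  qed
  have "(norm_V N E1 E2)\<^sup>2 + (norm_M N D)\<^sup>2 \<le> (3 * b)\<^sup>2 + (3 * b)\<^sup>2 + (3 * b)\<^sup>2"
    unfolding norm_V_def norm_V1_def norm_V2_def norm_M_def
    using double_sum_square_le[of "{1..?n-1}" "{1..?n}" E1 "3 * b" N]
      double_sum_square_le[of "{1..?n}" "{1..?n-1}" E2 "3 * b" N]
      double_sum_square_le[of "{1..?n}" "{1..?n}" D "3 * b" N] E1 E2 D N
    by (simp add: sum_nonneg)
  also have "\<dots> = 27 * b\<^sup>2" by (simp add: power_mult_distrib)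
  finally have data: "(norm_V N E1 E2)\<^sup>2 + (norm_M N D)\<^sup>2 \<le> 27 * b\<^sup>2" .
  note stable = mac_stability[OF N e mac]
  \<comment> \<open>The value \<open>10 ^ 8\<close> works since
    \<open>27 * 10 ^ 14 \<le> (10 ^ 8)^2\<close>.\<close>
  have bound: "x \<le> (10 ^ 8 * b)\<^sup>2" if "x \<le> c * ((norm_V N E1 E2)\<^sup>2 + (norm_M N D)\<^sup>2)" "0 \<le> c" "c \<le> 10 ^ 14" for x c
  proof -
    have "x \<le> c * (27 * b\<^sup>2)" using that(1) mult_left_mono[OF data that(2)] by (rule order_trans)
    also have "\<dots> \<le> 10 ^ 14 * (27 * b\<^sup>2)" using that(3) by (rule mult_right_mono) simp
    also have "\<dots> \<le> (10 ^ 8 * b)\<^sup>2" by (simp add: power_mult_distrib)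
    finally show ?thesis .
  qed
  have "(seminorm_H1 N e1 e2)\<^sup>2 \<le> (10 ^ 8 * b)\<^sup>2" by (rule bound[OF stable(1)]) simp_all
  moreover have "(norm_M N ep)\<^sup>2 \<le> (10 ^ 8 * b)\<^sup>2" by (rule bound[OF stable(2)]) simp_all
  ultimately show H1: "seminorm_H1 N e1 e2 \<le> 10 ^ 8 * b" and "norm_M N ep \<le> 10 ^ 8 * b"
    using b by (auto intro: power2_le_imp_le)
  show "norm_V N e1 e2 \<le> 10 ^ 8 * b"
    using norm_V_le_seminorm_H1[OF N e(1,2)] H1 by linarith
qed

theorem theorem4p1:
  fixes \<Omega>p :: "(real \<times> real) set" and k r :: nat and K :: real
  assumes "interface_domain \<Omega>p" and "k \<ge> 4"
  shows "\<exists>C>0. \<forall>f1 f2 \<psi> u1 u2 p u1_hat u2_hat p_hat.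
    stokes_interface_solution \<Omega>p f1 f2 \<psi> u1 u2 p \<longrightarrow>
    pw_smooth \<Omega>p k u1 \<longrightarrow> pw_smooth \<Omega>p k u2 \<longrightarrow> pw_smooth \<Omega>p (k - 1) p \<longrightarrow>
    auxiliary_functions \<Omega>p k r K f1 f2 u1 u2 p u1_hat u2_hat p_hat \<longrightarrow>
    (\<forall>N u1_h u2_h p_h.
      fine_grid \<Omega>p N \<longrightarrow>
      modified_mac_solution \<Omega>p N f1 f2 u1 u2 p u1_h u2_h p_h \<longrightarrow>
      (let h = 1 / real N;
           e1 = err_u1 N u1_h (perturbed u1 u1_hat h);
           e2 = err_u2 N u2_h (perturbed u2 u2_hat h);
           ep = err_p N p_h (perturbed p p_hat h);
           S = sup_norm_vec \<Omega>p 4 u1 u2 + sup_norm \<Omega>p 3 p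
       in e1 \<in> V1 N \<and> e2 \<in> V2 N \<and> ep \<in> M_h N \<and>
          seminorm_H1 N e1 e2 \<le> C * h\<^sup>2 * S \<and>
          norm_V N e1 e2 \<le> C * h\<^sup>2 * S \<and>
          norm_M N ep \<le> C * h\<^sup>2 * S))"
proof (intro exI[of _ "10 ^ 8 * (\<bar>K\<bar> + 1)"] conjI allI impI)
  show "0 < 10 ^ 8 * (\<bar>K\<bar> + 1)" by simp
next
  fix f1 f2 \<psi> u1 u2 p u1_hat u2_hat p_hat N u1_h u2_h p_h
  assume smooth: "pw_smooth \<Omega>p k u1" "pw_smooth \<Omega>p k u2" "pw_smooth \<Omega>p (k - 1) p"
    and aux: "auxiliary_functions \<Omega>p k r K f1 f2 u1 u2 p u1_hat u2_hat p_hat"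
    and fine: "fine_grid \<Omega>p N"
    and sol: "modified_mac_solution \<Omega>p N f1 f2 u1 u2 p u1_h u2_h p_h"
  define h S where "h = 1 / real N" and "S = sup_norm_vec \<Omega>p 4 u1 u2 + sup_norm \<Omega>p 3 p"
  define u1t u2t pt where "u1t = perturbed u1 u1_hat h" and "u2t = perturbed u2 u2_hat h"
    and "pt = perturbed p p_hat h"
  define b where "b = (\<bar>K\<bar> + 1) * h\<^sup>2 * S"
  have N: "0 < N" using fine by (simp add: fine_grid_def)
  have ne: "\<Omega>p \<noteq> {}" using assms(1) by (simp add: interface_domain_def)
  have p3: "3 \<le> k - 1" using assms(2) by simp
  have nonneg: "0 \<le> sup_norm \<Omega>p 4 u1" "0 \<le> sup_norm \<Omega>p 4 u2" "0 \<le> sup_norm \<Omega>p 3 p"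
    using sup_norm_nonneg[OF smooth(1) assms(2) ne] sup_norm_nonneg[OF smooth(2) assms(2) ne]
      sup_norm_nonneg[OF smooth(3) p3 ne] by auto
  have mono: "sup_norm \<Omega>p 3 u1 \<le> sup_norm \<Omega>p 4 u1" "sup_norm \<Omega>p 3 u2 \<le> sup_norm \<Omega>p 4 u2"
    using sup_norm_mono[OF smooth(1) _ assms(2) ne] sup_norm_mono[OF smooth(2) _ assms(2) ne] by auto
  have S: "0 \<le> S" "sup_norm \<Omega>p 4 u1 + sup_norm \<Omega>p 3 p \<le> S" "sup_norm \<Omega>p 4 u2 + sup_norm \<Omega>p 3 p \<le> S"
    "sup_norm \<Omega>p 3 u1 + sup_norm \<Omega>p 3 u2 \<le> 2 * S"
    using nonneg mono by (auto simp: S_def sup_norm_vec_def)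
  have nonneg3: "0 \<le> sup_norm \<Omega>p 3 u1" "0 \<le> sup_norm \<Omega>p 3 u2"
    using sup_norm_nonneg[OF smooth(1) _ ne, of 3] sup_norm_nonneg[OF smooth(2) _ ne, of 3] assms(2) by auto
  \<comment> \<open>Since \<open>K\<close> may be negative or zero, \<open>\<bar>K\<bar> + 1\<close>
    takes its place; this also makes the final constant positive.\<close>
  have Kb: "K * h\<^sup>2 * s \<le> c * b" if "0 \<le> s" "s \<le> c * S" for s c
  proof -
    have "K * h\<^sup>2 * s \<le> (\<bar>K\<bar> + 1) * h\<^sup>2 * s" using that by (intro mult_right_mono) auto
    also have "\<dots> \<le> (\<bar>K\<bar> + 1) * h\<^sup>2 * (c * S)" using that by (intro mult_left_mono) auto
    finally show ?thesis by (simp add: b_def algebra_simps)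
  qed
  have K4: "K * h ^ 4 * S \<le> h\<^sup>2 * b"
    using mult_left_mono[OF Kb[of S 1], of "h\<^sup>2"] S(1) by (simp add: power2_eq_square power4_eq_xxxx mult.commute mult.left_commute)
  obtain R1 R2 R where
    mac: "mac_equations N (\<lambda>i j. rhs1 \<Omega>p h f1 u1 p i j + R1 i j) (\<lambda>i j. rhs2 \<Omega>p h f2 u2 p i j + R2 i j)
        (\<lambda>i j. rhs_div \<Omega>p h u1 u2 i j + R i j)
        (\<lambda>i j. u1t (node_u1 h i j)) (\<lambda>i j. u2t (node_u2 h i j)) (\<lambda>i j. pt (node_p h i j))"
    and res1: "\<forall>i\<in>{1..int N - 1}. \<forall>j\<in>{1..int N}. \<bar>R1 i j\<bar> \<le> K * h\<^sup>2 * (sup_norm \<Omega>p 4 u1 + sup_norm \<Omega>p 3 p)"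
    and res2: "\<forall>i\<in>{1..int N}. \<forall>j\<in>{1..int N - 1}. \<bar>R2 i j\<bar> \<le> K * h\<^sup>2 * (sup_norm \<Omega>p 4 u2 + sup_norm \<Omega>p 3 p)"
    and res: "\<forall>i\<in>{1..int N}. \<forall>j\<in>{1..int N}. \<bar>R i j\<bar> \<le> K * h\<^sup>2 * (sup_norm \<Omega>p 3 u1 + sup_norm \<Omega>p 3 u2)"
    and bdx: "\<forall>x\<in>{0..1}. \<bar>u1t (x, - h / 2) + u1t (x, h / 2)\<bar> \<le> K * h ^ 4 * S \<and>
        \<bar>u1t (x, 1 - h / 2) + u1t (x, 1 + h / 2)\<bar> \<le> K * h ^ 4 * S \<and> u2t (x, 0) = 0 \<and> u2t (x, 1) = 0"
    and bdy: "\<forall>y\<in>{0..1}. \<bar>u2t (- h / 2, y) + u2t (h / 2, y)\<bar> \<le> K * h ^ 4 * S \<and>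
        \<bar>u2t (1 - h / 2, y) + u2t (1 + h / 2, y)\<bar> \<le> K * h ^ 4 * S \<and> u1t (0, y) = 0 \<and> u1t (1, y) = 0"
  proof -
    note a = conjunct2[OF aux[unfolded auxiliary_functions_def], rule_format, OF fine, unfolded Let_def,
        folded h_def, folded S_def u1t_def u2t_def pt_def]
    from conjunct1[OF a] conjunct2[OF a] show ?thesis using that by blast
  qed
  note sol' = sol[unfolded modified_mac_solution_def, folded h_def]
  have rR1: "\<bar>R1 i j\<bar> \<le> b" if "i \<in> {1..int N - 1}" "j \<in> {1..int N}" for i j
    using res1 that Kb[of "sup_norm \<Omega>p 4 u1 + sup_norm \<Omega>p 3 p" 1] S nonneg by force
  have rR2: "\<bar>R2 i j\<bar> \<le> b" if "i \<in> {1..int N}" "j \<in> {1..int N - 1}" for i j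
    using res2 that Kb[of "sup_norm \<Omega>p 4 u2 + sup_norm \<Omega>p 3 p" 1] S nonneg by force
  have rR: "\<bar>R i j\<bar> \<le> 2 * b" if "i \<in> {1..int N}" "j \<in> {1..int N}" for i j
    using res that Kb[of "sup_norm \<Omega>p 3 u1 + sup_norm \<Omega>p 3 u2" 2] S nonneg3 by force
  have "0 \<le> b" using S(1) by (simp add: b_def)
  note est = mac_error_estimate[of N u1_h u2_h "rhs1 \<Omega>p h f1 u1 p" "rhs2 \<Omega>p h f2 u2 p"
      "rhs_div \<Omega>p h u1 u2" p_h R1 R2 R u1t u2t pt b, folded h_def,
      OF N _ _ _ mac rR1 rR2 rR _ _ _ _ _ _ _ _ this]
  have est: "err_u1 N u1_h u1t \<in> V1 N" "err_u2 N u2_h u2t \<in> V2 N" "err_p N p_h pt \<in> M_h N"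
    "seminorm_H1 N (err_u1 N u1_h u1t) (err_u2 N u2_h u2t) \<le> 10 ^ 8 * b"
    "norm_V N (err_u1 N u1_h u1t) (err_u2 N u2_h u2t) \<le> 10 ^ 8 * b"
    "norm_M N (err_p N p_h pt) \<le> 10 ^ 8 * b"
    by (rule est; use sol' bdx bdy K4 in \<open>blast intro: order_trans\<close>)+
  have "10 ^ 8 * b = 10 ^ 8 * (\<bar>K\<bar> + 1) * h\<^sup>2 * S" by (simp only: b_def mult.assoc)
  show "let h = 1 / real N;
           e1 = err_u1 N u1_h (perturbed u1 u1_hat h);
           e2 = err_u2 N u2_h (perturbed u2 u2_hat h);
           ep = err_p N p_h (perturbed p p_hat h);
           S = sup_norm_vec \<Omega>p 4 u1 u2 + sup_norm \<Omega>p 3 p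
       in e1 \<in> V1 N \<and> e2 \<in> V2 N \<and> ep \<in> M_h N \<and>
          seminorm_H1 N e1 e2 \<le> 10 ^ 8 * (\<bar>K\<bar> + 1) * h\<^sup>2 * S \<and>
          norm_V N e1 e2 \<le> 10 ^ 8 * (\<bar>K\<bar> + 1) * h\<^sup>2 * S \<and>
          norm_M N ep \<le> 10 ^ 8 * (\<bar>K\<bar> + 1) * h\<^sup>2 * S"
    unfolding Let_def h_def[symmetric] S_def[symmetric] u1t_def[symmetric] u2t_def[symmetric] pt_def[symmetric]
    by (intro conjI est[unfolded \<open>10 ^ 8 * b = _\<close>])
qed

end
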